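(* Fix $\eta\in[0,1]$ and an integer $N\ge0$, and let $\bar C_{\mathrm{BEHC}}(N)$ be the capacity of the boosted BEHC$(N)$. Then $$\bar C_{\mathrm{BEHC}}(N)\ \le\ \sup I(U^{+},U;X\mid Q),$$ where the supremum is over (finite) auxiliary alphabets $\mathcal U$, functions $f:\mathcal U\times\{0,1\}\to\{0,1\}$ with $f(u^{+},0)=0$ for all $u^{+}$, and policies $P(u^{+}\mid u,q)$ ($u,u^{+}\in\mathcal U$, $q\in\mathcal Q$) for which the kernel $T(s^{+},u^{+},q^{+}\mid s,u,q)=\sum_xP(u^{+}\mid u,q)\mathbb{1}\{x=f(u^{+},s)\}\mathbb{1}\{q^{+}=g_U(q,x)\}P_U(s^{+}\mid x,s,q)$ has a unique stationary distribution $\pi(s,u,q)$, and the mutual information is computed under the joint PMF $$\pi(s,u,q)P(u^{+}\mid u,q)\mathbb{1}\{x=f(u^{+},s)\}P_U(s^{+}\mid x,s,q)\mathbb{1}\{q^{+}=g_U(q,x)\}.$$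
   Context: $\bar\eta=1-\eta$, $[a:b]=\{a,\dots,b\}$. $\mathcal Q=[0:N]$, $g_U:\mathcal Q\times\{0,1\}\to\mathcal Q$: $g_U(q,1)=0$, $g_U(q,0)=q+1$ for $q\in[0:N-1]$, $g_U(N,0)=N$. BEHC battery law: $P(S^{+}=0\mid x,s)=\bar\eta\,\mathbb{1}\{x=s\}$ for $x\le s$. Modified law: $P_U(s^{+}\mid x,s,q)=\mathbb{1}\{s^{+}=1\}$ if $q\in\{N-1,N\}$ and $x=0$, and equal to the BEHC law otherwise. Boosted BEHC$(N)$: binary inputs with $X_i\le S_{i-1}$, $S_0=0$, $Q_0=0$, $Q_i=g_U(Q_{i-1},X_i)$, $S_i\sim P_U(\cdot\mid X_i,S_{i-1},Q_{i-1})$ given the past, output $Y_i=X_i$ (a BEHC with i.i.d. Bernoulli$(\eta)$ energy arrivals in which transmitting $N$ consecutive zeros charges the battery). Codes: message $M$ uniform on $\{1,\dots,2^{nR}\}$, encoder $X_i=e_i(M,S^{i-1},Y^{i-1})$ with $X_i\le S_{i-1}$, decoder $\hat M=d(Y^n)$; $R$ achievable if average error probability $\to0$; capacity is the supremum of achievable rates. *)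

theory Defs
  imports "HOL-Analysis.Analysis"
begin

text \<open>Binary symbols (inputs, battery states) are naturals in {0,1};
  the counter alphabet is Q = {0..N}.\<close>

definition gU :: "nat \<Rightarrow> nat \<Rightarrow> nat \<Rightarrow> nat" where
  "gU N q x = (if x = 1 then 0 else min (q + 1) N)"

text \<open>BEHC battery law P(s'|x,s) (meaningful for x \<le> s):
  P(S'=0|x,s) = (1-eta) [x = s], P(S'=1|x,s) = 1 - P(S'=0|x,s).\<close>
definition behc_law :: "real \<Rightarrow> nat \<Rightarrow> nat \<Rightarrow> nat \<Rightarrow> real" where
  "behc_law \<eta> x s s' =
     (let p0 = (if x = s then 1 - \<eta> else 0)
      in if s' = 0 then p0 else if s' = 1 then 1 - p0 else 0)"

text \<open>Modified law P_U(s'|x,s,q).  Note N - 1 is truncated subtraction;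
  for N = 0 the set {N-1,N} meets Q = {0} in {0}, as in the paper.\<close>
definition PU :: "real \<Rightarrow> nat \<Rightarrow> nat \<Rightarrow> nat \<Rightarrow> nat \<Rightarrow> nat \<Rightarrow> real" where
  "PU \<eta> N x s q s' =
     (if (q = N - 1 \<or> q = N) \<and> x = 0 then (if s' = 1 then 1 else 0)
      else behc_law \<eta> x s s')"

text \<open>An encoder e i m shist yhist gives X_i from the message m,
  S^{i-1} = [s_1,...,s_{i-1}] and Y^{i-1} = [y_1,...,y_{i-1}].
  Given a realisation sl = [s_1,...,s_n] of the battery states,
  enc_x e m sl i is the list [x_1,...,x_i] (outputs Y_j = X_j).\<close>
fun enc_x :: "(nat \<Rightarrow> nat \<Rightarrow> nat list \<Rightarrow> nat list \<Rightarrow> nat) \<Rightarrow> nat \<Rightarrow> nat list \<Rightarrow> nat \<Rightarrow> nat list" where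
  "enc_x e m sl 0 = []"
| "enc_x e m sl (Suc i) = (let xs = enc_x e m sl i in xs @ [e (Suc i) m (take i sl) xs])"

definition q_after :: "nat \<Rightarrow> nat list \<Rightarrow> nat" where
  "q_after N xs = foldl (gU N) 0 xs"

definition state_seqs :: "nat \<Rightarrow> nat list set" where
  "state_seqs n = {sl. length sl = n \<and> set sl \<subseteq> {0, 1}}"

definition state_prob :: "real \<Rightarrow> nat \<Rightarrow> (nat \<Rightarrow> nat \<Rightarrow> nat list \<Rightarrow> nat list \<Rightarrow> nat)
    \<Rightarrow> nat \<Rightarrow> nat \<Rightarrow> nat list \<Rightarrow> real" where
  "state_prob \<eta> N e n m sl =
     (let xs = enc_x e m sl n
      in \<Prod>i\<in>{1..n}. PU \<eta> N (xs ! (i - 1)) ((0 # sl) ! (i - 1))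
                         (q_after N (take (i - 1) xs)) (sl ! (i - 1)))"

definition valid_code :: "nat \<Rightarrow> (nat \<Rightarrow> nat \<Rightarrow> nat list \<Rightarrow> nat list \<Rightarrow> nat) \<Rightarrow> nat \<Rightarrow> nat \<Rightarrow> bool" where
  "valid_code N e n M \<longleftrightarrow>
     (\<forall>m\<in>{1..M}. \<forall>sl\<in>state_seqs n. \<forall>i\<in>{1..n}.
        enc_x e m sl n ! (i - 1) \<le> (0 # sl) ! (i - 1))"

definition err_prob :: "real \<Rightarrow> nat \<Rightarrow> (nat \<Rightarrow> nat \<Rightarrow> nat list \<Rightarrow> nat list \<Rightarrow> nat)
    \<Rightarrow> (nat list \<Rightarrow> nat) \<Rightarrow> nat \<Rightarrow> nat \<Rightarrow> real" where
  "err_prob \<eta> N e d n M =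
     (1 / real M) * (\<Sum>m\<in>{1..M}. \<Sum>sl\<in>state_seqs n.
        state_prob \<eta> N e n m sl * (if d (enc_x e m sl n) \<noteq> m then 1 else 0))"

definition num_msgs :: "real \<Rightarrow> nat \<Rightarrow> nat" where
  "num_msgs R n = nat \<lceil>2 powr (real n * R)\<rceil>"

definition achievable :: "real \<Rightarrow> nat \<Rightarrow> real \<Rightarrow> bool" where
  "achievable \<eta> N R \<longleftrightarrow>
     (\<exists>E :: nat \<Rightarrow> (nat \<Rightarrow> nat \<Rightarrow> nat list \<Rightarrow> nat list \<Rightarrow> nat).
      \<exists>D :: nat \<Rightarrow> (nat list \<Rightarrow> nat).
        (\<forall>n. valid_code N (E n) n (num_msgs R n)) \<and>
        (\<lambda>n. err_prob \<eta> N (E n) (D n) n (num_msgs R n)) \<longlonglongrightarrow> 0)"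

definition boosted_capacity :: "real \<Rightarrow> nat \<Rightarrow> ereal" where
  "boosted_capacity \<eta> N = Sup {ereal R | R. achievable \<eta> N R}"

definition cond_mi :: "'a set \<Rightarrow> 'b set \<Rightarrow> 'c set \<Rightarrow> ('a \<Rightarrow> 'b \<Rightarrow> 'c \<Rightarrow> real) \<Rightarrow> real" where
  "cond_mi A B C p =
     (\<Sum>a\<in>A. \<Sum>b\<in>B. \<Sum>c\<in>C.
        if p a b c = 0 then 0
        else p a b c * log 2 (p a b c * (\<Sum>a'\<in>A. \<Sum>b'\<in>B. p a' b' c)
                              / ((\<Sum>b'\<in>B. p a b' c) * (\<Sum>a'\<in>A. p a' b c))))"

text \<open>Auxiliary alphabet U = {0..<k}; state space {0,1} x U x Q.\<close>
definition Omega :: "nat \<Rightarrow> nat \<Rightarrow> (nat \<times> nat \<times> nat) set" where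
  "Omega k N = {0, 1} \<times> {0..<k} \<times> {0..N}"

definition valid_f :: "nat \<Rightarrow> (nat \<Rightarrow> nat \<Rightarrow> nat) \<Rightarrow> bool" where
  "valid_f k f \<longleftrightarrow> (\<forall>u\<in>{0..<k}. \<forall>s\<in>{0, 1}. f u s \<in> {0, 1}) \<and> (\<forall>u\<in>{0..<k}. f u 0 = 0)"

text \<open>P u' u q = P(u^+ = u' | u, q).\<close>
definition valid_policy :: "nat \<Rightarrow> nat \<Rightarrow> (nat \<Rightarrow> nat \<Rightarrow> nat \<Rightarrow> real) \<Rightarrow> bool" where
  "valid_policy k N P \<longleftrightarrow>
     (\<forall>u\<in>{0..<k}. \<forall>q\<in>{0..N}.
        (\<forall>u'\<in>{0..<k}. P u' u q \<ge> 0) \<and> (\<Sum>u'\<in>{0..<k}. P u' u q) = 1)"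

definition kernelT :: "real \<Rightarrow> nat \<Rightarrow> (nat \<Rightarrow> nat \<Rightarrow> nat) \<Rightarrow> (nat \<Rightarrow> nat \<Rightarrow> nat \<Rightarrow> real)
    \<Rightarrow> nat \<times> nat \<times> nat \<Rightarrow> nat \<times> nat \<times> nat \<Rightarrow> real" where
  "kernelT \<eta> N f P w' w =
     (case w of (s, u, q) \<Rightarrow> case w' of (s', u', q') \<Rightarrow>
        \<Sum>x\<in>{0, 1}. P u' u q * (if x = f u' s then 1 else 0)
                    * (if q' = gU N q x then 1 else 0) * PU \<eta> N x s q s')"

definition stationary :: "real \<Rightarrow> nat \<Rightarrow> nat \<Rightarrow> (nat \<Rightarrow> nat \<Rightarrow> nat) \<Rightarrow> (nat \<Rightarrow> nat \<Rightarrow> nat \<Rightarrow> real)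
    \<Rightarrow> (nat \<times> nat \<times> nat \<Rightarrow> real) \<Rightarrow> bool" where
  "stationary \<eta> N k f P \<pi> \<longleftrightarrow>
     (\<forall>w\<in>Omega k N. \<pi> w \<ge> 0) \<and> (\<forall>w. w \<notin> Omega k N \<longrightarrow> \<pi> w = 0) \<and>
     (\<Sum>w\<in>Omega k N. \<pi> w) = 1 \<and>
     (\<forall>w'\<in>Omega k N. \<pi> w' = (\<Sum>w\<in>Omega k N. \<pi> w * kernelT \<eta> N f P w' w))"

definition joint_uux_q :: "real \<Rightarrow> nat \<Rightarrow> (nat \<Rightarrow> nat \<Rightarrow> nat) \<Rightarrow> (nat \<Rightarrow> nat \<Rightarrow> nat \<Rightarrow> real)
    \<Rightarrow> (nat \<times> nat \<times> nat \<Rightarrow> real) \<Rightarrow> nat \<times> nat \<Rightarrow> nat \<Rightarrow> nat \<Rightarrow> real" where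
  "joint_uux_q \<eta> N f P \<pi> uu x q =
     (case uu of (u', u) \<Rightarrow>
       \<Sum>s\<in>{0, 1}. \<Sum>s'\<in>{0, 1}. \<Sum>q'\<in>{0..N}.
         \<pi> (s, u, q) * P u' u q * (if x = f u' s then 1 else 0)
         * PU \<eta> N x s q s' * (if q' = gU N q x then 1 else 0))"

definition upper_bound :: "real \<Rightarrow> nat \<Rightarrow> ereal" where
  "upper_bound \<eta> N = Sup {ereal (cond_mi ({0..<k} \<times> {0..<k}) {0, 1} {0..N}
                               (joint_uux_q \<eta> N f P (THE \<pi>. stationary \<eta> N k f P \<pi>)))
                          | k f P. k \<ge> 1 \<and> valid_f k f \<and> valid_policy k N P \<and>
                                   (\<exists>!\<pi>. stationary \<eta> N k f P \<pi>)}"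

end

theory Submission
  imports Defs
begin

text \<open>
  Let \<open>N \<ge> 1\<close> (for \<open>N = 0\<close> the bound is at least 1: alternate the strategies \<open>x = 0\<close> and \<open>x = s\<close>).
  Given a code of length \<open>n\<close>, let the auxiliary symbol run through blocks of length \<open>n + N + 1\<close>:
  \<open>N\<close> zeros charge the battery surely, a one then resets the counter and leaves a battery that is
  Bernoulli(\<open>\<eta>\<close>) and independent of the past, and then a uniform message is sent with the code. This
  renewal makes the stationary law unique. As \<open>q = 0\<close> exactly after an input 1, the auxiliary symbol can
  record all inputs of the block, and given message and past inputs a random strategy bit, drawn without
  knowledge of the battery, reproduces the input law of the code: the weight of a full
  battery dominates the one under the code, because both obey the same monotone recursion and the
  code starts with an empty battery.

  For the test conditional law of \<open>X\<close> given message and past inputs, Gibbs' inequality bounds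
  \<open>(n + N + 1) I(U\<^sup>+, U; X | Q)\<close> from below by the divergence of the code's input law from the path
  measure \<open>\<Prod> \<pi>(x\<^sub>i | q\<^sub>i\<^sub>-\<^sub>1)\<close>, which is at least \<open>(1 - \<epsilon>) log M - 1\<close> by a change of measure.
\<close>

section \<open>Information inequalities\<close>

text \<open>This is \<open>ln y \<le> y - 1\<close> at \<open>y = t / p\<close>, in base 2. Summed
  over an alphabet the left side becomes a difference of total masses, so test weights of total mass
  at most that of \<open>p\<close> yield a nonnegative divergence.\<close>

lemma gibbs_term:
  fixes p t :: real
  assumes "0 \<le> p" "0 \<le> t" "p > 0 \<Longrightarrow> t > 0"
  shows "(p - t) / ln 2 \<le> p * log 2 (p / t)"
proof (cases "p = 0")
  case False
  with assms have p: "p > 0" "t > 0" by auto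
  have "ln (t / p) \<le> t / p - 1"
    using p by (intro ln_le_minus_one) simp
  hence "p * ln (t / p) \<le> p * (t / p - 1)"
    using p by (intro mult_left_mono) auto
  hence "p - t \<le> p * ln (p / t)"
    using p by (simp add: ln_div algebra_simps)
  hence "(p - t) / ln 2 \<le> (p * ln (p / t)) / ln 2"
    by (intro divide_right_mono) auto
  thus ?thesis by (simp add: log_def)
qed (use assms in simp)

text \<open>Variational bound: a (sub)stochastic test law \<open>\<rho>\<close> of \<open>b\<close>
  given \<open>a, c\<close>, put in place of the true conditional law, can only lower the mutual
  information, because the gap is the divergence of \<open>p\<close> from the marginal of
  \<open>a, c\<close> times \<open>\<rho>\<close>. The denominator inside the logarithm is the true
  law of \<open>b\<close> given \<open>c\<close>.\<close>

lemma cond_mi_ge: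
  fixes p \<rho> :: "'a \<Rightarrow> 'b \<Rightarrow> 'c \<Rightarrow> real"
  assumes fin: "finite A" "finite B" "finite C"
    and p: "\<And>a b c. a \<in> A \<Longrightarrow> b \<in> B \<Longrightarrow> c \<in> C \<Longrightarrow> 0 \<le> p a b c"
    and \<rho>: "\<And>a b c. a \<in> A \<Longrightarrow> b \<in> B \<Longrightarrow> c \<in> C \<Longrightarrow> 0 \<le> \<rho> a b c"
    and \<rho>_sum: "\<And>a c. a \<in> A \<Longrightarrow> c \<in> C \<Longrightarrow> (\<Sum>b\<in>B. \<rho> a b c) \<le> 1"
    and \<rho>_pos: "\<And>a b c. a \<in> A \<Longrightarrow> b \<in> B \<Longrightarrow> c \<in> C \<Longrightarrow> p a b c > 0 \<Longrightarrow> \<rho> a b c > 0"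
  shows "(\<Sum>a\<in>A. \<Sum>b\<in>B. \<Sum>c\<in>C. p a b c *
            log 2 (\<rho> a b c / ((\<Sum>a'\<in>A. p a' b c) / (\<Sum>a'\<in>A. \<Sum>b'\<in>B. p a' b' c))))
         \<le> cond_mi A B C p"
proof -
  define pAC where "pAC a c = (\<Sum>b'\<in>B. p a b' c)" for a c
  define pBC where "pBC b c = (\<Sum>a'\<in>A. p a' b c)" for b c
  define pC where "pC c = (\<Sum>a'\<in>A. \<Sum>b'\<in>B. p a' b' c)" for c
  have pAC_ge: "p a b c \<le> pAC a c" if "a \<in> A" "b \<in> B" "c \<in> C" for a b c
    unfolding pAC_def using that fin p by (intro member_le_sum) auto
  have pBC_ge: "p a b c \<le> pBC b c" if "a \<in> A" "b \<in> B" "c \<in> C" for a b c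
    unfolding pBC_def using that fin p by (intro member_le_sum[of _ _ "\<lambda>a. p a b c"]) auto
  have pC_ge: "pAC a c \<le> pC c" if "a \<in> A" "c \<in> C" for a c
    unfolding pC_def pAC_def using that fin p
    by (intro member_le_sum[of _ _ "\<lambda>a. \<Sum>b'\<in>B. p a b' c"] sum_nonneg) auto
  have pAC_nn: "0 \<le> pAC a c" if "a \<in> A" "c \<in> C" for a c
    unfolding pAC_def using that p by (intro sum_nonneg) auto
  \<comment> \<open>The correction \<open>(p - pAC * \<rho>) / ln 2\<close> comes from Gibbs'
    inequality and has a nonnegative sum because \<open>\<rho>\<close> is substochastic in
    \<open>b\<close>.\<close>
  have *: "p a b c * log 2 (\<rho> a b c / (pBC b c / pC c)) + (p a b c - pAC a c * \<rho> a b c) / ln 2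
        \<le> (if p a b c = 0 then 0 else p a b c * log 2 (p a b c * pC c / (pAC a c * pBC b c)))"
    if "a \<in> A" "b \<in> B" "c \<in> C" for a b c
  proof (cases "p a b c = 0")
    case True
    thus ?thesis using pAC_nn[OF that(1,3)] \<rho>[OF that] by (simp add: divide_nonpos_pos)
  next
    case False
    hence pos: "p a b c > 0" using p[OF that] by simp
    note P = pos pAC_ge[OF that] pBC_ge[OF that] pC_ge[OF that(1,3)]
    have P': "pAC a c > 0" "pBC b c > 0" "pC c > 0" using P by linarith+
    have r: "\<rho> a b c > 0" using \<rho>_pos[OF that pos] .
    have "(p a b c - pAC a c * \<rho> a b c) / ln 2 \<le> p a b c * log 2 (p a b c / (pAC a c * \<rho> a b c))"
      using P' r pos by (intro gibbs_term) auto
    also have "\<dots> = p a b c * log 2 (p a b c * pC c / (pAC a c * pBC b c))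
                  - p a b c * log 2 (\<rho> a b c / (pBC b c / pC c))"
      using P' r pos by (simp add: log_divide log_mult algebra_simps)
    finally show ?thesis using False by simp
  qed
  have "0 \<le> (\<Sum>a\<in>A. \<Sum>c\<in>C. pAC a c * (1 - (\<Sum>b\<in>B. \<rho> a b c)))"
    using pAC_nn \<rho>_sum by (intro sum_nonneg mult_nonneg_nonneg) auto
  also have "\<dots> = (\<Sum>a\<in>A. \<Sum>c\<in>C. \<Sum>b\<in>B. p a b c - pAC a c * \<rho> a b c)"
    by (simp add: sum_subtractf right_diff_distrib pAC_def[symmetric] flip: sum_distrib_left)
  also have "\<dots> = (\<Sum>a\<in>A. \<Sum>b\<in>B. \<Sum>c\<in>C. p a b c - pAC a c * \<rho> a b c)"
    by (intro sum.cong refl sum.swap)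
  finally have "0 \<le> (\<Sum>a\<in>A. \<Sum>b\<in>B. \<Sum>c\<in>C. p a b c - pAC a c * \<rho> a b c) / ln 2"
    by simp
  hence "(\<Sum>a\<in>A. \<Sum>b\<in>B. \<Sum>c\<in>C. p a b c * log 2 (\<rho> a b c / (pBC b c / pC c)))
     \<le> (\<Sum>a\<in>A. \<Sum>b\<in>B. \<Sum>c\<in>C. p a b c * log 2 (\<rho> a b c / (pBC b c / pC c))
            + (p a b c - pAC a c * \<rho> a b c) / ln 2)"
    by (simp add: sum.distrib sum_divide_distrib)
  also have "\<dots> \<le> (\<Sum>a\<in>A. \<Sum>b\<in>B. \<Sum>c\<in>C.
       (if p a b c = 0 then 0 else p a b c * log 2 (p a b c * pC c / (pAC a c * pBC b c))))"
    by (intro sum_mono *)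
  also have "\<dots> = cond_mi A B C p"
    unfolding cond_mi_def pAC_def pBC_def pC_def ..
  finally show ?thesis unfolding pBC_def pC_def .
qed

text \<open>Gibbs' inequality against the test weights \<open>G x * M/2\<close> on correctly decoded pairs and
  \<open>G x * 1/2\<close> elsewhere yields Fano's bound without binary entropies.\<close>
lemma fano_change_of_measure:
  fixes W :: "nat \<Rightarrow> 'x \<Rightarrow> real" and G :: "'x \<Rightarrow> real" and d :: "'x \<Rightarrow> nat"
  assumes fin: "finite X" and M: "M \<ge> 1"
    and W: "\<And>m x. m \<in> {1..M} \<Longrightarrow> x \<in> X \<Longrightarrow> 0 \<le> W m x"
    and W_sum: "\<And>m. m \<in> {1..M} \<Longrightarrow> (\<Sum>x\<in>X. W m x) = 1"
    and G: "\<And>x. x \<in> X \<Longrightarrow> 0 \<le> G x" and G_sum: "(\<Sum>x\<in>X. G x) \<le> 1"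
    and G_pos: "\<And>m x. m \<in> {1..M} \<Longrightarrow> x \<in> X \<Longrightarrow> W m x > 0 \<Longrightarrow> G x > 0"
    and \<epsilon>: "\<epsilon> = (1 / real M) * (\<Sum>m\<in>{1..M}. \<Sum>x\<in>X. W m x * (if d x \<noteq> m then 1 else 0))"
  shows "(1 - \<epsilon>) * log 2 (real M) - 1
    \<le> (1 / real M) * (\<Sum>m\<in>{1..M}. \<Sum>x\<in>X. W m x * log 2 (W m x / G x))"
proof -
  define c where "c m x = (if d x = m then real M / 2 else 1 / 2)" for m x
  have c: "c m x > 0" for m x using M by (simp add: c_def)
  have Mpos: "real M > 0" using M by simp
  have term_le: "W m x * (log 2 (real M) - 1 - log 2 (real M) * (if d x \<noteq> m then 1 else 0))
        + (W m x - G x * c m x) / ln 2 \<le> W m x * log 2 (W m x / G x)"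
    if "m \<in> {1..M}" "x \<in> X" for m x
  proof -
    have lc: "log 2 (c m x) = log 2 (real M) - 1 - log 2 (real M) * (if d x \<noteq> m then 1 else 0)"
      using Mpos by (simp add: c_def log_divide)
    have "(W m x - G x * c m x) / ln 2 \<le> W m x * log 2 (W m x / (G x * c m x))"
      using W[OF that] G[OF that(2)] G_pos[OF that] c[of m x]
      by (intro gibbs_term) auto
    also have "\<dots> = W m x * log 2 (W m x / G x) - W m x * log 2 (c m x)"
    proof (cases "W m x = 0")
      case False
      hence "W m x > 0" "G x > 0" using W[OF that] G_pos[OF that] by auto
      thus ?thesis using c[of m x] by (simp add: log_divide log_mult algebra_simps)
    qed simp
    finally show ?thesis unfolding lc by simp
  qed
  \<comment> \<open>For each \<open>x\<close> at most one message is decoded correctly, so the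
    weights \<open>c m x\<close> add up over \<open>m\<close> to at most
    \<open>M/2 + M/2\<close>.\<close>
  have "(\<Sum>m\<in>{1..M}. \<Sum>x\<in>X. G x * c m x) = (\<Sum>x\<in>X. G x * (\<Sum>m\<in>{1..M}. c m x))"
    by (subst sum.swap) (simp add: sum_distrib_left)
  also have "\<dots> \<le> (\<Sum>x\<in>X. G x * real M)"
  proof (intro sum_mono mult_left_mono G)
    fix x
    have "(\<Sum>m\<in>{1..M}. c m x) \<le> (\<Sum>m\<in>{1..M}. (if d x = m then real M / 2 else 0) + 1 / 2)"
      by (intro sum_mono) (simp add: c_def)
    also have "\<dots> = (\<Sum>m\<in>{1..M}. (if d x = m then real M / 2 else 0)) + real M / 2"
      by (simp add: sum.distrib)
    also have "\<dots> \<le> real M" by (subst sum.delta') auto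
    finally show "(\<Sum>m\<in>{1..M}. c m x) \<le> real M" .
  qed
  also have "\<dots> \<le> real M"
    using G_sum Mpos by (simp flip: sum_distrib_right)
  finally have T: "(\<Sum>m\<in>{1..M}. \<Sum>x\<in>X. G x * c m x) \<le> real M" .
  have WM: "(\<Sum>m\<in>{1..M}. \<Sum>x\<in>X. W m x) = real M" using W_sum by simp
  have "real M * ((1 - \<epsilon>) * log 2 (real M) - 1)
      = (log 2 (real M) - 1) * real M - log 2 (real M) * (real M * \<epsilon>)"
    by (simp add: algebra_simps)
  also have "real M * \<epsilon> = (\<Sum>m\<in>{1..M}. \<Sum>x\<in>X. W m x * (if d x \<noteq> m then 1 else 0))"
    using Mpos by (simp add: \<epsilon>)
  also have "(log 2 (real M) - 1) * real M - log 2 (real M) * \<dots>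
      = (\<Sum>m\<in>{1..M}. \<Sum>x\<in>X. W m x * (log 2 (real M) - 1 - log 2 (real M) * (if d x \<noteq> m then 1 else 0)))"
    unfolding WM[symmetric] sum_distrib_left sum_subtractf[symmetric]
    by (intro sum.cong refl) (simp add: algebra_simps)
  also have "\<dots> \<le> \<dots> + ((\<Sum>m\<in>{1..M}. \<Sum>x\<in>X. W m x) - (\<Sum>m\<in>{1..M}. \<Sum>x\<in>X. G x * c m x)) / ln 2"
    using T WM by simp
  also have "\<dots> = (\<Sum>m\<in>{1..M}. \<Sum>x\<in>X. W m x * (log 2 (real M) - 1 - log 2 (real M) * (if d x \<noteq> m then 1 else 0))
        + (W m x - G x * c m x) / ln 2)"
    by (simp only: sum.distrib sum_subtractf sum_divide_distrib diff_divide_distrib)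
  also have "\<dots> \<le> (\<Sum>m\<in>{1..M}. \<Sum>x\<in>X. W m x * log 2 (W m x / G x))"
    by (intro sum_mono term_le)
  finally show ?thesis
    using Mpos by (simp add: field_simps)
qed

section \<open>Input law of a code\<close>

lemma finite_state_seqs [simp]: "finite (state_seqs n)"
proof -
  have "state_seqs n = {xs. set xs \<subseteq> {0, 1} \<and> length xs = n}"
    by (auto simp: state_seqs_def)
  thus ?thesis using finite_lists_length_eq[of "{0, 1 :: nat}" n] by simp
qed

lemma state_seqs_0 [simp]: "state_seqs 0 = {[]}"
  by (auto simp: state_seqs_def)

lemma snoc_in_state_seqs [simp]:
  "xs @ [x] \<in> state_seqs (Suc n) \<longleftrightarrow> xs \<in> state_seqs n \<and> x \<in> {0, 1}"
  by (auto simp: state_seqs_def)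

lemma sum_state_seqs_Suc:
  "(\<Sum>xs\<in>state_seqs (Suc n). g xs) = (\<Sum>xs\<in>state_seqs n. \<Sum>x\<in>{0, 1}. g (xs @ [x]))"
proof -
  have "bij_betw (\<lambda>(xs, x). xs @ [x]) (state_seqs n \<times> {0, 1}) (state_seqs (Suc n))"
  proof (rule bij_betw_imageI)
    show "(\<lambda>(xs, x). xs @ [x]) ` (state_seqs n \<times> {0, 1}) = state_seqs (Suc n)"
    proof (intro equalityI subsetI)
      fix ys assume ys: "ys \<in> state_seqs (Suc n)"
      then obtain xs x where "ys = xs @ [x]"
        by (cases ys rule: rev_cases) (auto simp: state_seqs_def)
      thus "ys \<in> (\<lambda>(xs, x). xs @ [x]) ` (state_seqs n \<times> {0, 1})"
        using ys by force
    qed auto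
  qed (auto simp: inj_on_def)
  from sum.reindex_bij_betw[OF this, of g] show ?thesis
    unfolding sum.cartesian_product by (simp add: case_prod_unfold)
qed

lemma length_enc_x [simp]: "length (enc_x e m sl i) = i"
  by (induction i) (auto simp: Let_def)

text \<open>Causality of the encoder: the last of the first \<open>i\<close> inputs sees only
  \<open>i - 1\<close> battery states, hence the slack of one in the bound.\<close>

lemma enc_x_append:
  "i \<le> Suc (length sl) \<Longrightarrow> enc_x e m (sl @ sl') i = enc_x e m sl i"
  by (induction i) (auto simp: Let_def)

lemma nth_enc_x:
  "j < i \<Longrightarrow> enc_x e m sl i ! j = e (Suc j) m (take j sl) (enc_x e m sl j)"
  by (induction i) (auto simp: Let_def nth_append less_Suc_eq)

lemma q_after_snoc: "q_after N (xs @ [x]) = gU N (q_after N xs) x"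
  by (simp add: q_after_def)

lemma q_after_Nil [simp]: "q_after N [] = 0"
  by (simp add: q_after_def)

lemma gU_le: "gU N q x \<le> N"
  by (simp add: gU_def)

lemma q_after_le: "q_after N xs \<le> N"
  by (cases xs rule: rev_cases) (simp_all add: q_after_snoc gU_le)

lemma PU_nonneg: "0 \<le> \<eta> \<Longrightarrow> \<eta> \<le> 1 \<Longrightarrow> 0 \<le> PU \<eta> N x s q s'"
  by (simp add: PU_def behc_law_def Let_def)

lemma PU_sum: "PU \<eta> N x s q 0 + PU \<eta> N x s q (Suc 0) = 1"
  by (simp add: PU_def behc_law_def Let_def)

lemma last_state:
  "sl \<in> state_seqs i \<Longrightarrow> last (0 # sl) = 0 \<or> last (0 # sl) = 1"
  by (cases sl rule: rev_cases) (auto simp: state_seqs_def)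

text \<open>\<open>last (0 # sl)\<close> is the current battery state, including the empty initial
  battery. In this form the product over time becomes a recursion over appended states.\<close>

lemma state_prob_snoc:
  assumes "length sl = i"
  shows "state_prob \<eta> N e (Suc i) m (sl @ [s]) = state_prob \<eta> N e i m sl *
     PU \<eta> N (e (Suc i) m sl (enc_x e m sl i)) (last (0 # sl)) (q_after N (enc_x e m sl i)) s"
proof -
  let ?xs = "enc_x e m sl i" and ?y = "e (Suc i) m sl (enc_x e m sl i)"
  have enc: "enc_x e m (sl @ [s]) (Suc i) = ?xs @ [?y]"
    using assms by (simp add: Let_def enc_x_append)
  have "state_prob \<eta> N e (Suc i) m (sl @ [s]) =
     (\<Prod>j\<in>{1..Suc i}. PU \<eta> N ((?xs @ [?y]) ! (j - 1)) ((0 # sl @ [s]) ! (j - 1))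
                         (q_after N (take (j - 1) (?xs @ [?y]))) ((sl @ [s]) ! (j - 1)))"
    unfolding state_prob_def enc Let_def ..
  also have "{1..Suc i} = insert (Suc i) {1..i}" by auto
  also have "(\<Prod>j\<in>\<dots>. PU \<eta> N ((?xs @ [?y]) ! (j - 1)) ((0 # sl @ [s]) ! (j - 1))
                         (q_after N (take (j - 1) (?xs @ [?y]))) ((sl @ [s]) ! (j - 1)))
     = (\<Prod>j\<in>{1..i}. PU \<eta> N ((?xs @ [?y]) ! (j - 1)) ((0 # sl @ [s]) ! (j - 1))
                         (q_after N (take (j - 1) (?xs @ [?y]))) ((sl @ [s]) ! (j - 1))) *
       PU \<eta> N ?y ((0 # sl @ [s]) ! i) (q_after N ?xs) s"
    using assms by (simp add: nth_append)
  also have "(\<Prod>j\<in>{1..i}. PU \<eta> N ((?xs @ [?y]) ! (j - 1)) ((0 # sl @ [s]) ! (j - 1))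
                         (q_after N (take (j - 1) (?xs @ [?y]))) ((sl @ [s]) ! (j - 1)))
     = state_prob \<eta> N e i m sl"
    unfolding state_prob_def Let_def using assms
    by (intro prod.cong refl arg_cong2[where f = "\<lambda>q s. PU \<eta> N _ _ q s"] )
       (auto simp: nth_append nth_Cons split: nat.splits)
  also have "(0 # sl @ [s]) ! i = last (0 # sl)"
    using assms by (auto simp: nth_Cons last_conv_nth nth_append split: nat.splits)
  finally show ?thesis by simp
qed

section \<open>Prefix probabilities of a code and the charge of the battery along them\<close>

text \<open>The charge recursion after an input 0 with total weight \<open>w\<close>, of which \<open>d\<close> had a full battery.\<close>
definition charge_idle :: "real \<Rightarrow> nat \<Rightarrow> nat \<Rightarrow> real \<Rightarrow> real \<Rightarrow> real" where
  "charge_idle \<eta> N q w d = (if q = N - 1 \<or> q = N then w else d + \<eta> * (w - d))"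

text \<open>Away from the counters that charge surely the recursion is
  \<open>(1 - \<eta>) * d + \<eta> * w\<close>, and at those counters it is constant in
  \<open>d\<close>. Monotonicity is what lets two batteries with different initial laws be
  compared.\<close>

lemma charge_idle_mono:
  assumes "\<eta> \<le> 1" "d \<le> d'"
  shows "charge_idle \<eta> N q w d \<le> charge_idle \<eta> N q w d'"
proof -
  have "(1 - \<eta>) * d \<le> (1 - \<eta>) * d'" using assms by (intro mult_left_mono) auto
  thus ?thesis by (simp add: charge_idle_def algebra_simps)
qed

text \<open>The value \<open>d = w\<close> is a fixed point, so monotonicity gives the
  bound.\<close>

lemma charge_idle_le:
  assumes "\<eta> \<le> 1" "d \<le> w"
  shows "charge_idle \<eta> N q w d \<le> w"
  using charge_idle_mono[OF assms, of N q w]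
  by (cases "q = N - 1 \<or> q = N") (simp_all add: charge_idle_def)

locale boosted_code =
  fixes \<eta> :: real and N :: nat and e :: "nat \<Rightarrow> nat \<Rightarrow> nat list \<Rightarrow> nat list \<Rightarrow> nat" and m n :: nat
  assumes eta: "0 \<le> \<eta>" "\<eta> \<le> 1"
    and input_le: "\<And>sl i. sl \<in> state_seqs n \<Longrightarrow> i < n \<Longrightarrow> enc_x e m sl n ! i \<le> (0 # sl) ! i"
begin

definition next_input :: "nat list \<Rightarrow> nat" where
  "next_input sl = e (Suc (length sl)) m sl (enc_x e m sl (length sl))"

text \<open>The probability that the fixed message \<open>m\<close> produces the input prefix
  \<open>xs\<close>; \<open>charged\<close> is the part of it with a full battery after
  \<open>xs\<close>. These two weights are all that is kept of the code.\<close>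

definition law :: "nat list \<Rightarrow> real" where
  "law xs = (\<Sum>sl\<in>state_seqs (length xs).
     if enc_x e m sl (length xs) = xs then state_prob \<eta> N e (length xs) m sl else 0)"

definition charged :: "nat list \<Rightarrow> real" where
  "charged xs = (\<Sum>sl\<in>state_seqs (length xs).
     if enc_x e m sl (length xs) = xs \<and> last (0 # sl) = 1
     then state_prob \<eta> N e (length xs) m sl else 0)"

lemma next_input_le:
  assumes "sl \<in> state_seqs i" "i < n"
  shows "next_input sl \<le> last (0 # sl)"
proof -
  \<comment> \<open>Validity is stated for state sequences of full length \<open>n\<close>, so
    \<open>sl\<close> is padded; by causality the padding does not affect the input in
    question.\<close>
  let ?sl = "sl @ replicate (n - i) 0"
  have len: "length sl = i" using assms by (simp add: state_seqs_def)
  have "?sl \<in> state_seqs n" using assms by (auto simp: state_seqs_def)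
  hence "enc_x e m ?sl n ! i \<le> (0 # ?sl) ! i" using assms(2) by (rule input_le)
  also have "enc_x e m ?sl n ! i = next_input sl"
    using assms(2) len by (simp add: nth_enc_x enc_x_append next_input_def)
  also have "(0 # ?sl) ! i = last (0 # sl)"
    using len by (auto simp: nth_Cons last_conv_nth nth_append split: nat.splits)
  finally show ?thesis .
qed

lemma enc_x_snoc:
  assumes "sl \<in> state_seqs i"
  shows "enc_x e m (sl @ [s]) (Suc i) = enc_x e m sl i @ [next_input sl]"
  using assms by (simp add: next_input_def state_seqs_def Let_def enc_x_append)

text \<open>An encoder may return any natural number; it is the energy constraint, with binary
  battery states, that makes the inputs binary.\<close>

lemma enc_x_in_state_seqs:
  assumes "sl \<in> state_seqs i" "i \<le> n"
  shows "enc_x e m sl i \<in> state_seqs i"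
  using assms
proof (induction i arbitrary: sl)
  case (Suc i)
  then obtain sl' s where sl: "sl = sl' @ [s]" "sl' \<in> state_seqs i"
    by (cases sl rule: rev_cases) (auto simp: state_seqs_def)
  hence "next_input sl' \<in> {0, 1}"
    using next_input_le[of sl' i] last_state[of sl' i] Suc.prems by auto
  thus ?case using Suc sl by (simp add: enc_x_snoc del: enc_x.simps)
qed simp

lemma state_prob_nonneg: "0 \<le> state_prob \<eta> N e i m sl"
  using eta by (auto simp: state_prob_def Let_def intro!: prod_nonneg PU_nonneg)

lemma law_nonneg: "0 \<le> law xs"
  unfolding law_def by (intro sum_nonneg) (simp add: state_prob_nonneg)

lemma law_Nil: "law [] = 1"
  by (simp add: law_def state_prob_def)

lemma charged_Nil: "charged [] = 0"
  by (simp add: charged_def)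

lemma state_prob_snoc':
  assumes "sl \<in> state_seqs i"
  shows "state_prob \<eta> N e (Suc i) m (sl @ [s]) = state_prob \<eta> N e i m sl *
     PU \<eta> N (next_input sl) (last (0 # sl)) (q_after N (enc_x e m sl i)) s"
  using assms by (subst state_prob_snoc) (auto simp: state_seqs_def next_input_def)

text \<open>The state following the last input is summed out by \<open>PU_sum\<close>, which leaves
  exactly the states that the encoder has seen.\<close>

lemma law_snoc:
  assumes "length xs = i"
  shows "law (xs @ [x]) = (\<Sum>sl\<in>state_seqs i.
     if enc_x e m sl i = xs \<and> next_input sl = x then state_prob \<eta> N e i m sl else 0)"
proof -
  have "law (xs @ [x]) = (\<Sum>sl\<in>state_seqs i. \<Sum>s\<in>{0, 1}.
     if enc_x e m (sl @ [s]) (Suc i) = xs @ [x] then state_prob \<eta> N e (Suc i) m (sl @ [s]) else 0)"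
    unfolding law_def length_append_singleton assms sum_state_seqs_Suc ..
  also have "\<dots> = (\<Sum>sl\<in>state_seqs i.
     if enc_x e m sl i = xs \<and> next_input sl = x then state_prob \<eta> N e i m sl else 0)"
  proof (intro sum.cong refl)
    fix sl assume sl: "sl \<in> state_seqs i"
    show "(\<Sum>s\<in>{0, 1}. if enc_x e m (sl @ [s]) (Suc i) = xs @ [x]
         then state_prob \<eta> N e (Suc i) m (sl @ [s]) else 0) =
      (if enc_x e m sl i = xs \<and> next_input sl = x then state_prob \<eta> N e i m sl else 0)"
      using sl by (simp add: enc_x_snoc state_prob_snoc' PU_sum del: enc_x.simps flip: distrib_left)
  qed
  finally show ?thesis .
qed

lemma charged_snoc:
  assumes "length xs = i"
  shows "charged (xs @ [x]) = (\<Sum>sl\<in>state_seqs i.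
     if enc_x e m sl i = xs \<and> next_input sl = x
     then state_prob \<eta> N e i m sl * PU \<eta> N x (last (0 # sl)) (q_after N xs) 1 else 0)"
proof -
  have "charged (xs @ [x]) = (\<Sum>sl\<in>state_seqs i. \<Sum>s\<in>{0, 1}.
     if enc_x e m (sl @ [s]) (Suc i) = xs @ [x] \<and> s = 1
     then state_prob \<eta> N e (Suc i) m (sl @ [s]) else 0)"
    unfolding charged_def length_append_singleton assms sum_state_seqs_Suc
    by (simp del: enc_x.simps)
  also have "\<dots> = (\<Sum>sl\<in>state_seqs i.
     if enc_x e m sl i = xs \<and> next_input sl = x
     then state_prob \<eta> N e i m sl * PU \<eta> N x (last (0 # sl)) (q_after N xs) 1 else 0)"
    by (intro sum.cong refl) (auto simp: enc_x_snoc state_prob_snoc' simp del: enc_x.simps)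
  finally show ?thesis .
qed

lemma law_split:
  assumes "length xs < n"
  shows "law xs = law (xs @ [0]) + law (xs @ [1])"
  unfolding law_snoc[OF refl] sum.distrib[symmetric] unfolding law_def
proof (intro sum.cong refl)
  fix sl assume sl: "sl \<in> state_seqs (length xs)"
  have "next_input sl = 0 \<or> next_input sl = 1"
    using next_input_le[OF sl assms] last_state[OF sl] by linarith
  thus "(if enc_x e m sl (length xs) = xs then state_prob \<eta> N e (length xs) m sl else 0) =
       (if enc_x e m sl (length xs) = xs \<and> next_input sl = 0
        then state_prob \<eta> N e (length xs) m sl else 0) +
       (if enc_x e m sl (length xs) = xs \<and> next_input sl = 1
        then state_prob \<eta> N e (length xs) m sl else 0)"
    by auto
qed

text \<open>A one can be sent only from a full battery.\<close>

lemma law_one_le_charged: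
  assumes "length xs < n"
  shows "law (xs @ [1]) \<le> charged xs"
  unfolding law_snoc[OF refl] charged_def
proof (intro sum_mono)
  fix sl assume sl: "sl \<in> state_seqs (length xs)"
  show "(if enc_x e m sl (length xs) = xs \<and> next_input sl = 1
        then state_prob \<eta> N e (length xs) m sl else 0)
    \<le> (if enc_x e m sl (length xs) = xs \<and> last (0 # sl) = 1
        then state_prob \<eta> N e (length xs) m sl else 0)"
    using next_input_le[OF sl assms] last_state[OF sl] state_prob_nonneg
    by (auto simp del: last.simps)
qed

lemma charged_one:
  assumes "length xs < n"
  shows "charged (xs @ [1]) = \<eta> * law (xs @ [1])"
  unfolding law_snoc[OF refl] charged_snoc[OF refl] sum_distrib_left
proof (intro sum.cong refl)
  fix sl assume sl: "sl \<in> state_seqs (length xs)"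
  show "(if enc_x e m sl (length xs) = xs \<and> next_input sl = 1
        then state_prob \<eta> N e (length xs) m sl * PU \<eta> N 1 (last (0 # sl)) (q_after N xs) 1 else 0)
    = \<eta> * (if enc_x e m sl (length xs) = xs \<and> next_input sl = 1
        then state_prob \<eta> N e (length xs) m sl else 0)"
    using next_input_le[OF sl assms] last_state[OF sl]
    by (auto simp: PU_def behc_law_def simp del: last.simps)
qed

text \<open>Removing the paths that send a one leaves \<open>charged xs - law (xs @ [1])\<close> as
  the weight of idle paths with a full battery. For a fixed counter \<open>charge_idle\<close> is
  linear in its two weights, so the recursion for single paths sums to one for the totals.\<close>

lemma charged_idle:
  assumes "length xs < n"
  shows "charged (xs @ [0]) =
    charge_idle \<eta> N (q_after N xs) (law (xs @ [0])) (charged xs - law (xs @ [1]))"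
proof -
  let ?i = "length xs" and ?q = "q_after N xs"
  define c where "c sl = (if enc_x e m sl ?i = xs \<and> next_input sl = 0
        then state_prob \<eta> N e ?i m sl else 0)" for sl
  define d where "d sl = (if enc_x e m sl ?i = xs \<and> next_input sl = 0 \<and> last (0 # sl) = 1
        then state_prob \<eta> N e ?i m sl else 0)" for sl
  have D: "charged xs - law (xs @ [1]) = (\<Sum>sl\<in>state_seqs ?i. d sl)"
    unfolding law_snoc[OF refl] charged_def sum_subtractf[symmetric]
  proof (intro sum.cong refl)
    fix sl assume sl: "sl \<in> state_seqs ?i"
    show "(if enc_x e m sl ?i = xs \<and> last (0 # sl) = 1 then state_prob \<eta> N e ?i m sl else 0) -
       (if enc_x e m sl ?i = xs \<and> next_input sl = 1 then state_prob \<eta> N e ?i m sl else 0) = d sl"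
      using next_input_le[OF sl assms] last_state[OF sl] by (auto simp: d_def simp del: last.simps)
  qed
  have C: "law (xs @ [0]) = (\<Sum>sl\<in>state_seqs ?i. c sl)"
    unfolding law_snoc[OF refl] c_def ..
  have "charged (xs @ [0]) = (\<Sum>sl\<in>state_seqs ?i. charge_idle \<eta> N ?q (c sl) (d sl))"
    unfolding charged_snoc[OF refl]
  proof (intro sum.cong refl)
    fix sl assume sl: "sl \<in> state_seqs ?i"
    show "(if enc_x e m sl ?i = xs \<and> next_input sl = 0
        then state_prob \<eta> N e ?i m sl * PU \<eta> N 0 (last (0 # sl)) ?q 1 else 0)
       = charge_idle \<eta> N ?q (c sl) (d sl)"
      using last_state[OF sl]
      by (auto simp: c_def d_def charge_idle_def PU_def behc_law_def simp del: last.simps)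
  qed
  also have "\<dots> = charge_idle \<eta> N ?q (\<Sum>sl\<in>state_seqs ?i. c sl) (\<Sum>sl\<in>state_seqs ?i. d sl)"
    by (simp add: charge_idle_def sum.distrib sum_distrib_left sum_subtractf right_diff_distrib)
  finally show ?thesis unfolding C D .
qed

text \<open>Change of variables from battery states to inputs: the error probability is a sum over
  states, whereas the information estimates are sums over input sequences.\<close>

lemma sum_law:
  assumes "i \<le> n"
  shows "(\<Sum>xs\<in>state_seqs i. law xs * \<phi> xs) =
    (\<Sum>sl\<in>state_seqs i. state_prob \<eta> N e i m sl * \<phi> (enc_x e m sl i))"
proof -
  have "(\<Sum>xs\<in>state_seqs i. law xs * \<phi> xs) = (\<Sum>xs\<in>state_seqs i. \<Sum>sl\<in>state_seqs i.
     if enc_x e m sl i = xs then state_prob \<eta> N e i m sl * \<phi> xs else 0)"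
  proof (intro sum.cong refl)
    fix xs assume "xs \<in> state_seqs i"
    hence "length xs = i" by (simp add: state_seqs_def)
    thus "law xs * \<phi> xs = (\<Sum>sl\<in>state_seqs i.
       if enc_x e m sl i = xs then state_prob \<eta> N e i m sl * \<phi> xs else 0)"
      by (auto simp: law_def sum_distrib_right intro!: sum.cong)
  qed
  also have "\<dots> = (\<Sum>sl\<in>state_seqs i. state_prob \<eta> N e i m sl * \<phi> (enc_x e m sl i))"
    by (subst sum.swap) (simp add: sum.delta' enc_x_in_state_seqs assms)
  finally show ?thesis .
qed

end

section \<open>Cyclic Markov chains with a renewal phase\<close>

text \<open>The phase advances deterministically modulo \<open>L\<close>, and every
  \<open>good\<close> state of the last phase moves to phase 0 with the same law
  \<open>\<mu>\<close>. A cycle started in phase 0 visits only \<open>good\<close> states.\<close>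

locale cyclic_chain =
  fixes \<Omega> :: "'w set" and T :: "'w \<Rightarrow> 'w \<Rightarrow> real" and phase :: "'w \<Rightarrow> nat" and L :: nat
    and good :: "'w \<Rightarrow> bool" and \<mu> :: "'w \<Rightarrow> real"
  assumes fin: "finite \<Omega>"
    and T_nonneg: "\<And>w w'. w \<in> \<Omega> \<Longrightarrow> w' \<in> \<Omega> \<Longrightarrow> 0 \<le> T w' w"
    and T_sum: "\<And>w. w \<in> \<Omega> \<Longrightarrow> (\<Sum>w'\<in>\<Omega>. T w' w) = 1"
    and L_pos: "L > 0"
    and phase_less: "\<And>w. w \<in> \<Omega> \<Longrightarrow> phase w < L"
    and phase_step: "\<And>w w'. w \<in> \<Omega> \<Longrightarrow> w' \<in> \<Omega> \<Longrightarrow> T w' w \<noteq> 0 \<Longrightarrow>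
      phase w' = (if Suc (phase w) = L then 0 else Suc (phase w))"
    and good_0: "\<And>w. w \<in> \<Omega> \<Longrightarrow> phase w = 0 \<Longrightarrow> good w"
    and good_step: "\<And>w w'. w \<in> \<Omega> \<Longrightarrow> w' \<in> \<Omega> \<Longrightarrow> T w' w \<noteq> 0 \<Longrightarrow> good w \<Longrightarrow> phase w' \<noteq> 0 \<Longrightarrow> good w'"
    and renewal: "\<And>w w'. w \<in> \<Omega> \<Longrightarrow> w' \<in> \<Omega> \<Longrightarrow> Suc (phase w) = L \<Longrightarrow> good w \<Longrightarrow> phase w' = 0 \<Longrightarrow> T w' w = \<mu> w'"
    and \<mu>_nonneg: "\<And>w. w \<in> \<Omega> \<Longrightarrow> 0 \<le> \<mu> w"
    and \<mu>_sum: "(\<Sum>w\<in>{w\<in>\<Omega>. phase w = 0}. \<mu> w) = 1"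
begin

definition stat :: "('w \<Rightarrow> real) \<Rightarrow> bool" where
  "stat \<pi> \<longleftrightarrow> (\<forall>w\<in>\<Omega>. \<pi> w \<ge> 0) \<and> (\<forall>w. w \<notin> \<Omega> \<longrightarrow> \<pi> w = 0) \<and> (\<Sum>w\<in>\<Omega>. \<pi> w) = 1 \<and>
     (\<forall>w'\<in>\<Omega>. \<pi> w' = (\<Sum>w\<in>\<Omega>. \<pi> w * T w' w))"

definition slice :: "nat \<Rightarrow> 'w set" where
  "slice p = {w \<in> \<Omega>. phase w = p}"

lemma finite_slice [simp]: "finite (slice p)"
  using fin by (simp add: slice_def)

lemma sum_slices: "(\<Sum>w\<in>\<Omega>. g w) = (\<Sum>p<L. \<Sum>w\<in>slice p. g w)"
proof -
  have "(\<Sum>p<L. \<Sum>w\<in>slice p. g w) = (\<Sum>w\<in>(\<Union>p<L. slice p). g w)"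
    by (subst sum.UNION_disjoint) (auto simp: slice_def fin)
  also have "(\<Union>p<L. slice p) = \<Omega>" using phase_less by (auto simp: slice_def)
  finally show ?thesis by simp
qed

lemma inflow_Suc:
  assumes "w' \<in> \<Omega>" "phase w' = Suc p"
  shows "(\<Sum>w\<in>\<Omega>. g w * T w' w) = (\<Sum>w\<in>slice p. g w * T w' w)"
proof (rule sum.mono_neutral_right)
  show "\<forall>w\<in>\<Omega> - slice p. g w * T w' w = 0"
  proof
    fix w assume "w \<in> \<Omega> - slice p"
    thus "g w * T w' w = 0"
      using phase_step[of w w'] assms by (auto simp: slice_def split: if_splits)
  qed
qed (auto simp: slice_def fin)

lemma inflow_0:
  assumes "w' \<in> \<Omega>" "phase w' = 0"
  shows "(\<Sum>w\<in>\<Omega>. g w * T w' w) = (\<Sum>w\<in>slice (L - 1). g w * T w' w)"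
proof (rule sum.mono_neutral_right)
  show "\<forall>w\<in>\<Omega> - slice (L - 1). g w * T w' w = 0"
  proof
    fix w assume "w \<in> \<Omega> - slice (L - 1)"
    thus "g w * T w' w = 0"
      using phase_step[of w w'] assms by (auto simp: slice_def split: if_splits)
  qed
qed (auto simp: slice_def fin)

lemma outflow:
  assumes "w \<in> slice p" "Suc p < L"
  shows "(\<Sum>w'\<in>slice (Suc p). T w' w) = 1"
proof -
  have w: "w \<in> \<Omega>" "phase w = p" using assms by (auto simp: slice_def)
  have "(\<Sum>w'\<in>slice (Suc p). T w' w) = (\<Sum>w'\<in>\<Omega>. T w' w)"
    by (rule sum.mono_neutral_left)
       (use phase_step[OF w(1)] w(2) assms(2) fin in \<open>auto simp: slice_def\<close>)
  thus ?thesis using T_sum[OF w(1)] by simp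
qed

lemma mass_push:
  assumes "Suc p < L" "\<And>w'. w' \<in> slice (Suc p) \<Longrightarrow> g' w' = (\<Sum>w\<in>slice p. g w * T w' w)"
  shows "(\<Sum>w'\<in>slice (Suc p). g' w') = (\<Sum>w\<in>slice p. g w)"
proof -
  have "(\<Sum>w'\<in>slice (Suc p). g' w') = (\<Sum>w\<in>slice p. g w * (\<Sum>w'\<in>slice (Suc p). T w' w))"
    by (simp add: assms(2) sum.swap[of _ "slice p"] sum_distrib_left)
  thus ?thesis using outflow assms(1) by simp
qed

text \<open>Since \<open>\<mu>\<close> forgets the state it comes from, only the total mass of the
  last slice enters.\<close>

lemma renewal_inflow:
  assumes "w' \<in> \<Omega>" "phase w' = 0" "\<And>w. w \<in> slice (L - 1) \<Longrightarrow> g w \<noteq> 0 \<Longrightarrow> good w"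
  shows "(\<Sum>w\<in>slice (L - 1). g w * T w' w) = (\<Sum>w\<in>slice (L - 1). g w) * \<mu> w'"
  unfolding sum_distrib_right
proof (intro sum.cong refl)
  fix w assume w: "w \<in> slice (L - 1)"
  hence "w \<in> \<Omega>" "Suc (phase w) = L" using L_pos by (auto simp: slice_def)
  thus "g w * T w' w = g w * \<mu> w'"
    using renewal[of w w'] assms(1,2) assms(3)[OF w] by auto
qed

section \<open>Uniqueness of the stationary law\<close>

context
  fixes \<pi> :: "'w \<Rightarrow> real" assumes stat: "stat \<pi>"
begin

lemma stat_Suc:
  assumes "w' \<in> slice (Suc p)"
  shows "\<pi> w' = (\<Sum>w\<in>slice p. \<pi> w * T w' w)"
proof -
  have "w' \<in> \<Omega>" "phase w' = Suc p" using assms by (auto simp: slice_def)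
  thus ?thesis using stat inflow_Suc[of w' p \<pi>] unfolding stat_def by metis
qed

text \<open>Mass in a later phase comes only from the phase before, so it descends from phase 0,
  where all states are good.\<close>

lemma stat_good:
  assumes "w \<in> \<Omega>" "\<pi> w \<noteq> 0"
  shows "good w"
  using assms
proof (induction "phase w" arbitrary: w)
  case 0
  thus ?case using good_0 by simp
next
  case (Suc p w')
  hence "\<pi> w' = (\<Sum>w\<in>slice p. \<pi> w * T w' w)" by (intro stat_Suc) (simp add: slice_def)
  then obtain w where "w \<in> slice p" "\<pi> w * T w' w \<noteq> 0"
    using Suc.prems by (metis (no_types, lifting) sum.neutral)
  thus ?case using Suc.hyps(1)[of w] Suc.hyps(2) Suc.prems good_step[of w w']
    by (auto simp: slice_def)
qed

text \<open>One step carries the whole mass of a slice to the next slice, so the \<open>L\<close>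
  slices share the total mass equally.\<close>

lemma stat_mass: "p < L \<Longrightarrow> (\<Sum>w\<in>slice p. \<pi> w) = 1 / real L"
proof -
  have const: "(\<Sum>w\<in>slice p. \<pi> w) = (\<Sum>w\<in>slice 0. \<pi> w)" if "p < L" for p
    using that
  proof (induction p)
    case (Suc p)
    thus ?case using mass_push[OF _ stat_Suc, of p] by simp
  qed simp
  have "1 = (\<Sum>p<L. \<Sum>w\<in>slice p. \<pi> w)" using stat unfolding stat_def sum_slices by metis
  also have "\<dots> = (\<Sum>p<L. \<Sum>w\<in>slice 0. \<pi> w)" by (rule sum.cong[OF refl], rule const) simp
  also have "\<dots> = real L * (\<Sum>w\<in>slice 0. \<pi> w)" by simp
  finally show "p < L \<Longrightarrow> (\<Sum>w\<in>slice p. \<pi> w) = 1 / real L"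
    using const[of p] L_pos by (simp add: field_simps)
qed

text \<open>Renewal pins the stationary law down on phase 0; from there \<open>stat_Suc\<close>
  determines it phase by phase, which gives uniqueness.\<close>

lemma stat_0:
  assumes "w \<in> \<Omega>" "phase w = 0"
  shows "\<pi> w = \<mu> w / real L"
proof -
  have "\<pi> w = (\<Sum>w'\<in>slice (L - 1). \<pi> w' * T w w')"
    using stat inflow_0[OF assms, of \<pi>] assms(1) unfolding stat_def by metis
  also have "\<dots> = (\<Sum>w\<in>slice (L - 1). \<pi> w) * \<mu> w"
    using stat_good by (intro renewal_inflow assms) (auto simp: slice_def)
  finally show ?thesis using stat_mass L_pos by simp
qed

end

lemma stat_unique:
  assumes "stat \<pi>" "stat \<pi>'"
  shows "\<pi> = \<pi>'"
proof
  fix w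
  have "\<pi> w = \<pi>' w" if "w \<in> \<Omega>"
    using that
  proof (induction "phase w" arbitrary: w)
    case 0
    thus ?case using stat_0[OF assms(1), of w] stat_0[OF assms(2), of w] by simp
  next
    case (Suc p w')
    hence "w' \<in> slice (Suc p)" by (simp add: slice_def)
    moreover have "\<pi> w = \<pi>' w" if "w \<in> slice p" for w
      using that Suc.hyps(1)[of w] by (auto simp: slice_def)
    ultimately show ?case using stat_Suc assms by (metis (no_types, lifting) sum.cong)
  qed
  thus "\<pi> w = \<pi>' w" using assms by (cases "w \<in> \<Omega>") (auto simp: stat_def)
qed

section \<open>Existence of the stationary law\<close>

primrec cycle_law :: "nat \<Rightarrow> 'w \<Rightarrow> real" where
  "cycle_law 0 w = \<mu> w"
| "cycle_law (Suc p) w' = (\<Sum>w\<in>slice p. cycle_law p w * T w' w)"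

lemma cycle_law_nonneg: "w \<in> slice p \<Longrightarrow> 0 \<le> cycle_law p w"
  by (induction p arbitrary: w)
     (auto simp: slice_def \<mu>_nonneg T_nonneg intro!: sum_nonneg mult_nonneg_nonneg)

lemma cycle_law_mass: "p < L \<Longrightarrow> (\<Sum>w\<in>slice p. cycle_law p w) = 1"
proof (induction p)
  case 0
  thus ?case using \<mu>_sum by (simp add: slice_def)
next
  case (Suc p)
  thus ?case using mass_push[of p "cycle_law (Suc p)" "cycle_law p"] by simp
qed

lemma cycle_law_good:
  assumes "w \<in> slice p" "cycle_law p w \<noteq> 0"
  shows "good w"
  using assms
proof (induction p arbitrary: w)
  case 0
  thus ?case using good_0 by (simp add: slice_def)
next
  case (Suc p w')
  then obtain w where "w \<in> slice p" "cycle_law p w * T w' w \<noteq> 0"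
    by (metis (no_types, lifting) cycle_law.simps(2) sum.neutral)
  thus ?case using Suc.IH[of w] Suc.prems good_step[of w w'] by (auto simp: slice_def)
qed

text \<open>The law after \<open>p\<close> steps from \<open>\<mu>\<close>, averaged over the phases
  of one cycle, is invariant: within the cycle by construction, and across its end because the last
  slice has mass 1 and renews to \<open>\<mu>\<close>.\<close>

lemma stat_exists: "\<exists>\<pi>. stat \<pi>"
proof
  define \<pi> where "\<pi> w = (if w \<in> \<Omega> then cycle_law (phase w) w / real L else 0)" for w
  have \<pi>: "\<pi> w = cycle_law p w / real L" if "w \<in> slice p" for w p
    using that by (auto simp: \<pi>_def slice_def)
  have "(\<Sum>w\<in>\<Omega>. \<pi> w) = (\<Sum>p<L. (\<Sum>w\<in>slice p. cycle_law p w) / real L)"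
    by (simp add: sum_slices \<pi> sum_divide_distrib)
  also have "\<dots> = 1" using L_pos by (simp add: cycle_law_mass)
  finally have sum1: "(\<Sum>w\<in>\<Omega>. \<pi> w) = 1" .
  have "\<pi> w' = (\<Sum>w\<in>\<Omega>. \<pi> w * T w' w)" if w': "w' \<in> \<Omega>" for w'
  proof (cases "phase w'")
    case 0
    have "(\<Sum>w\<in>\<Omega>. \<pi> w * T w' w) = (\<Sum>w\<in>slice (L - 1). \<pi> w * T w' w)"
      by (rule inflow_0[OF w' 0])
    also have "\<dots> = (\<Sum>w\<in>slice (L - 1). \<pi> w) * \<mu> w'"
      by (rule renewal_inflow[OF w' 0]) (auto simp: \<pi> intro: cycle_law_good)
    also have "(\<Sum>w\<in>slice (L - 1). \<pi> w) = 1 / real L"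
      using cycle_law_mass[of "L - 1"] L_pos by (simp add: \<pi> flip: sum_divide_distrib)
    finally show ?thesis using w' 0 by (simp add: \<pi>_def)
  next
    case (Suc p)
    have "(\<Sum>w\<in>\<Omega>. \<pi> w * T w' w) = (\<Sum>w\<in>slice p. \<pi> w * T w' w)"
      by (rule inflow_Suc[OF w' Suc])
    also have "\<dots> = (\<Sum>w\<in>slice p. cycle_law p w * T w' w / real L)"
      by (intro sum.cong refl) (simp add: \<pi>)
    also have "\<dots> = cycle_law (Suc p) w' / real L" by (simp add: sum_divide_distrib)
    also have "\<dots> = \<pi> w'" using w' Suc by (simp add: \<pi>_def)
    finally show ?thesis ..
  qed
  moreover have "\<forall>w\<in>\<Omega>. 0 \<le> \<pi> w" using cycle_law_nonneg by (auto simp: \<pi>_def slice_def)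
  moreover have "\<forall>w. w \<notin> \<Omega> \<longrightarrow> \<pi> w = 0" by (simp add: \<pi>_def)
  ultimately show "stat \<pi>" using sum1 unfolding stat_def by blast
qed

lemma stat_ex1: "\<exists>!\<pi>. stat \<pi>"
  using stat_exists stat_unique by blast

end

section \<open>The block policy\<close>

text \<open>Auxiliary symbols of the policy built from a code: the \<open>Idle\<close> symbols recharge the battery,
  \<open>Fire\<close> then resets the counter, and \<open>Code m xs t\<close> tries to transmit \<open>t\<close> for message \<open>m\<close> after
  the inputs \<open>xs\<close> of the current block.\<close>
datatype act = Idle nat | Fire | Code nat "nat list" nat

fun act_input :: "act \<Rightarrow> nat \<Rightarrow> nat" where
  "act_input (Idle j) s = 0"
| "act_input Fire s = s"
| "act_input (Code m xs t) s = t * s"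

text \<open>Blocks are counted from \<open>Fire\<close>, so that the renewal takes place on entering
  phase 0. Code symbols occupy phases \<open>1\<close> to \<open>n\<close> and idle symbols phases
  \<open>n + 1\<close> to \<open>n + N\<close>.\<close>

fun act_phase :: "nat \<Rightarrow> act \<Rightarrow> nat" where
  "act_phase n Fire = 0"
| "act_phase n (Code m xs t) = Suc (length xs)"
| "act_phase n (Idle j) = Suc (n + j)"

lemma sum_Omega:
  "(\<Sum>w\<in>Omega k N. g w) = (\<Sum>s\<in>{0, 1}. \<Sum>u\<in>{0..<k}. \<Sum>q\<in>{0..N}. g (s, u, q))"
  unfolding Omega_def sum.cartesian_product by (simp add: case_prod_unfold)

lemma sum_of_bool_pair:
  fixes g :: "'a \<Rightarrow> 'b \<Rightarrow> real"
  assumes "finite A" "finite B" "a \<in> A" "b \<in> B"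
  shows "(\<Sum>a'\<in>A. \<Sum>b'\<in>B. if a' = a \<and> b' = b then g a' b' else 0) = g a b"
proof -
  have "(\<Sum>a'\<in>A. \<Sum>b'\<in>B. if a' = a \<and> b' = b then g a' b' else 0)
      = (\<Sum>a'\<in>A. if a' = a then \<Sum>b'\<in>B. if b' = b then g a' b' else 0 else 0)"
    by (intro sum.cong refl) auto
  thus ?thesis using assms by (simp add: sum.delta)
qed

text \<open>\<open>W m xs\<close> stands for the probability of the input prefix \<open>xs\<close>
  under the code, \<open>V m xs\<close> for its part with a full battery when the policy produces
  the same inputs. \<open>V m [] = \<eta>\<close> because a block starts right after
  \<open>Fire\<close>.\<close>

locale block_policy =
  fixes \<eta> :: real and N n M :: nat and W V :: "nat \<Rightarrow> nat list \<Rightarrow> real"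
  assumes eta: "0 \<le> \<eta>" "\<eta> \<le> 1"
    and N: "N \<ge> 1" and n: "n \<ge> 1" and M: "M \<ge> 1"
    and W_Nil: "\<And>m. m \<in> {1..M} \<Longrightarrow> W m [] = 1"
    and W_nonneg: "\<And>m xs. m \<in> {1..M} \<Longrightarrow> 0 \<le> W m xs"
    and W_split: "\<And>m xs i. m \<in> {1..M} \<Longrightarrow> xs \<in> state_seqs i \<Longrightarrow> i < n \<Longrightarrow>
      W m xs = W m (xs @ [0]) + W m (xs @ [1])"
    and V_Nil: "\<And>m. m \<in> {1..M} \<Longrightarrow> V m [] = \<eta>"
    and V_one: "\<And>m xs i. m \<in> {1..M} \<Longrightarrow> xs \<in> state_seqs i \<Longrightarrow> i < n \<Longrightarrow>
      V m (xs @ [1]) = \<eta> * W m (xs @ [1])"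
    and V_idle: "\<And>m xs i. m \<in> {1..M} \<Longrightarrow> xs \<in> state_seqs i \<Longrightarrow> i < n \<Longrightarrow>
      V m (xs @ [0]) = charge_idle \<eta> N (q_after N xs) (W m (xs @ [0])) (V m xs - W m (xs @ [1]))"
    and V_ge: "\<And>m xs i. m \<in> {1..M} \<Longrightarrow> xs \<in> state_seqs i \<Longrightarrow> i < n \<Longrightarrow> W m (xs @ [1]) \<le> V m xs"
    and V_le: "\<And>m xs i. m \<in> {1..M} \<Longrightarrow> xs \<in> state_seqs i \<Longrightarrow> i < n \<Longrightarrow> V m xs \<le> W m xs"
begin

definition hist :: "nat list set" where "hist = (\<Union>i<n. state_seqs i)"

definition acts :: "act set" where
  "acts = Idle ` {..<N} \<union> {Fire} \<union> (\<lambda>(m, xs, t). Code m xs t) ` ({1..M} \<times> hist \<times> {0, 1})"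

text \<open>The bit is drawn without access to the battery and produces a one only if the battery is
  full, which given \<open>xs\<close> has probability \<open>V m xs / W m xs\<close>. Dividing the
  desired conditional probability \<open>W m (xs @ [1]) / W m xs\<close> by it gives
  \<open>c\<close>. If \<open>V m xs = 0\<close>, then \<open>c = 0\<close> by the convention for
  division.\<close>

definition strategy_law :: "nat \<Rightarrow> nat list \<Rightarrow> nat \<Rightarrow> real" where
  "strategy_law m xs t = (let c = W m (xs @ [1]) / V m xs in if t = 1 then c else 1 - c)"

text \<open>The first argument is the next symbol. A code symbol extends its history by the input
  just sent, which the policy reads off the counter: \<open>q = 0\<close> stands for a one.\<close>

fun trans :: "act \<Rightarrow> act \<Rightarrow> nat \<Rightarrow> real" where
  "trans a' (Idle j) q = (if a' = (if Suc j < N then Idle (Suc j) else Fire) then 1 else 0)"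
| "trans a' Fire q = (case a' of Code m xs t \<Rightarrow> (if xs = [] then strategy_law m xs t / real M else 0) | _ \<Rightarrow> 0)"
| "trans a' (Code m xs t) q =
    (if Suc (length xs) < n then
       (case a' of Code m' xs' t' \<Rightarrow>
          (if m' = m \<and> xs' = xs @ [if q = 0 then 1 else 0] then strategy_law m' xs' t' else 0)
        | _ \<Rightarrow> 0)
     else if a' = Idle 0 then 1 else 0)"

lemma finite_hist [simp]: "finite hist"
  by (simp add: hist_def)

lemma finite_acts [simp]: "finite acts"
  by (simp add: acts_def)

lemma hist_iff: "xs \<in> hist \<longleftrightarrow> length xs < n \<and> set xs \<subseteq> {0, 1}"
  by (auto simp: hist_def state_seqs_def)

lemma histD: "xs \<in> hist \<Longrightarrow> xs \<in> state_seqs (length xs)" "xs \<in> hist \<Longrightarrow> length xs < n"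
  by (auto simp: hist_def state_seqs_def)

lemma Idle_in_acts [simp]: "Idle j \<in> acts \<longleftrightarrow> j < N"
  by (auto simp: acts_def)

lemma Fire_in_acts [simp]: "Fire \<in> acts"
  by (auto simp: acts_def)

lemma Code_in_acts [simp]: "Code m xs t \<in> acts \<longleftrightarrow> m \<in> {1..M} \<and> xs \<in> hist \<and> t \<in> {0, 1}"
  by (auto simp: acts_def image_iff)

lemma sum_acts:
  fixes g :: "act \<Rightarrow> real"
  shows "(\<Sum>a\<in>acts. g a) = (\<Sum>j<N. g (Idle j)) + g Fire +
    (\<Sum>m\<in>{1..M}. \<Sum>xs\<in>hist. \<Sum>t\<in>{0, 1}. g (Code m xs t))"
proof -
  have "(\<Sum>a\<in>acts. g a) = (\<Sum>a\<in>Idle ` {..<N}. g a) + g Fire +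
     (\<Sum>a\<in>(\<lambda>(m, xs, t). Code m xs t) ` ({1..M} \<times> hist \<times> {0, 1}). g a)"
    unfolding acts_def by (subst sum.union_disjoint, simp, simp, force)+ simp
  moreover have "(\<Sum>a\<in>Idle ` {..<N}. g a) = (\<Sum>j<N. g (Idle j))"
    by (subst sum.reindex) (auto simp: inj_on_def)
  moreover have "(\<Sum>a\<in>(\<lambda>(m, xs, t). Code m xs t) ` ({1..M} \<times> hist \<times> {0, 1}). g a) =
     (\<Sum>(m, xs, t)\<in>{1..M} \<times> hist \<times> {0, 1}. g (Code m xs t))"
    by (subst sum.reindex) (auto simp: inj_on_def intro!: sum.cong)
  ultimately show ?thesis by (simp only: sum.cartesian_product)
qed

lemma strategy_law_sum: "strategy_law m xs 0 + strategy_law m xs (Suc 0) = 1"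
  by (simp add: strategy_law_def Let_def)

lemma strategy_law_nonneg:
  assumes "m \<in> {1..M}" "xs \<in> hist"
  shows "0 \<le> strategy_law m xs t"
proof -
  note * = W_nonneg[OF assms(1), of "xs @ [1]"] V_ge[OF assms(1) histD[OF assms(2)]]
  from * have "W m (xs @ [1]) / V m xs \<le> 1" by (cases "V m xs = 0") (auto simp: field_simps)
  thus ?thesis using * by (simp add: strategy_law_def Let_def)
qed

lemma trans_nonneg: "a \<in> acts \<Longrightarrow> a' \<in> acts \<Longrightarrow> 0 \<le> trans a' a q"
  by (cases a; cases a') (auto intro!: strategy_law_nonneg divide_nonneg_nonneg)

lemma trans_sum:
  assumes "a \<in> acts"
  shows "(\<Sum>a'\<in>acts. trans a' a q) = 1"
proof (cases a)
  case (Idle j)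
  thus ?thesis by (simp add: sum.delta)
next
  case Fire
  have "[] \<in> hist" using n by (simp add: hist_iff)
  have inner: "(\<Sum>t\<in>{0, 1}. trans (Code m xs t) Fire q) = (if xs = [] then 1 / real M else 0)" for m xs
    by (simp add: strategy_law_sum flip: add_divide_distrib)
  have "(\<Sum>a'\<in>acts. trans a' a q) = (\<Sum>m\<in>{1..M}. \<Sum>xs\<in>hist. if xs = [] then 1 / real M else 0)"
    unfolding sum_acts Fire inner by simp
  also have "\<dots> = 1" using M \<open>[] \<in> hist\<close> by (simp add: sum.delta)
  finally show ?thesis .
next
  case (Code m xs t)
  hence *: "m \<in> {1..M}" "xs \<in> hist" using assms by auto
  show ?thesis
  proof (cases "Suc (length xs) < n")
    case True
    let ?ys = "xs @ [if q = 0 then 1 else 0]"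
    have ys: "?ys \<in> hist" using * True by (auto simp: hist_iff)
    have inner: "(\<Sum>t'\<in>{0, 1}. trans (Code m' xs' t') (Code m xs t) q) =
        (if m' = m \<and> xs' = ?ys then 1 else 0)" for m' xs'
      using True by (simp add: strategy_law_sum)
    have "(\<Sum>a'\<in>acts. trans a' a q) = (\<Sum>m'\<in>{1..M}. \<Sum>xs'\<in>hist. if m' = m \<and> xs' = ?ys then 1 else 0)"
      unfolding sum_acts Code inner using True by simp
    also have "\<dots> = 1" by (rule sum_of_bool_pair) (use * ys in auto)
    finally show ?thesis .
  next
    case False
    thus ?thesis using Code N by (simp add: sum.delta)
  qed
qed

section \<open>Numbering of the auxiliary symbols and validity of the policy\<close>

definition k :: nat where "k = card acts"

definition dec :: "nat \<Rightarrow> act" where "dec = (SOME h. bij_betw h {0..<k} acts)"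

lemma bij_dec: "bij_betw dec {0..<k} acts"
  using someI_ex[OF ex_bij_betw_nat_finite[OF finite_acts]] unfolding dec_def k_def .

lemma dec_in_acts: "u < k \<Longrightarrow> dec u \<in> acts"
  using bij_dec by (auto simp: bij_betw_def)

lemma sum_dec: "(\<Sum>u\<in>{0..<k}. g (dec u)) = (\<Sum>a\<in>acts. g a)"
  by (rule sum.reindex_bij_betw[OF bij_dec])

definition pol :: "nat \<Rightarrow> nat \<Rightarrow> nat \<Rightarrow> real" where
  "pol u' u q = trans (dec u') (dec u) q"

definition inp :: "nat \<Rightarrow> nat \<Rightarrow> nat" where
  "inp u s = act_input (dec u) s"

lemma k_ge: "k \<ge> 1"
proof -
  have "acts \<noteq> {}" using Fire_in_acts by blast
  thus ?thesis by (simp add: k_def Suc_le_eq card_gt_0_iff)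
qed

lemma act_input_bin: "a \<in> acts \<Longrightarrow> s \<in> {0, 1} \<Longrightarrow> act_input a s \<in> {0, 1}"
  by (cases a) auto

lemma valid_inp: "valid_f k inp"
proof -
  have "inp u 0 = 0" if "u < k" for u
    using dec_in_acts[OF that] by (cases "dec u") (auto simp: inp_def)
  moreover have "inp u s \<in> {0, 1}" if "u < k" "s \<in> {0, 1}" for u s
    using act_input_bin[OF dec_in_acts that(2)] that(1) by (simp add: inp_def)
  ultimately show ?thesis by (simp add: valid_f_def)
qed

lemma valid_pol: "valid_policy k N pol"
proof -
  have "(\<Sum>u'\<in>{0..<k}. pol u' u q) = 1" if "u < k" for u q
    unfolding pol_def sum_dec[of "\<lambda>a. trans a (dec u) q"] using that by (intro trans_sum dec_in_acts)
  moreover have "0 \<le> pol u' u q" if "u < k" "u' < k" for u u' q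
    unfolding pol_def using that by (intro trans_nonneg dec_in_acts)
  ultimately show ?thesis by (simp add: valid_policy_def)
qed

lemma kernel:
  assumes "s \<in> {0, 1}" "u' < k"
  shows "kernelT \<eta> N inp pol (s', u', q') (s, u, q) =
    (if q' = gU N q (act_input (dec u') s)
     then trans (dec u') (dec u) q * PU \<eta> N (act_input (dec u') s) s q s' else 0)"
proof -
  have "inp u' s = 0 \<or> inp u' s = 1"
    using act_input_bin[OF dec_in_acts[OF assms(2)] assms(1)] by (simp add: inp_def)
  thus ?thesis
    unfolding inp_def[symmetric] kernelT_def pol_def by (elim disjE) simp_all
qed

lemma trans_phase:
  assumes "a \<in> acts" "a' \<in> acts" "trans a' a q \<noteq> 0"
  shows "act_phase n a' = (if Suc (act_phase n a) = Suc (n + N) then 0 else Suc (act_phase n a))"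
  using assms by (cases a; cases a') (auto simp: hist_iff split: if_splits)

section \<open>Renewal structure of the block policy\<close>

definition phase :: "nat \<times> nat \<times> nat \<Rightarrow> nat" where
  "phase = (\<lambda>(s, u, q). act_phase n (dec u))"

text \<open>After \<open>Idle j\<close> at least \<open>j + 1\<close> zeros in a row have been sent.
  At \<open>j = N - 1\<close> this forces the counter to be \<open>N\<close>, and then the battery
  is full.\<close>

definition good :: "nat \<times> nat \<times> nat \<Rightarrow> bool" where
  "good = (\<lambda>(s, u, q). case dec u of Idle j \<Rightarrow> j < q \<and> (q = N \<longrightarrow> s = 1) | _ \<Rightarrow> True)"

text \<open>The law left behind when \<open>Fire\<close> meets a full battery: counter zero and a
  Bernoulli(\<open>\<eta>\<close>) battery. It does not mention \<open>u\<close>, because in phase 0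
  the symbol can only be \<open>Fire\<close>.\<close>

definition fresh :: "nat \<times> nat \<times> nat \<Rightarrow> real" where
  "fresh = (\<lambda>(s, u, q). if q = 0 then if s = 1 then \<eta> else 1 - \<eta> else 0)"

sublocale cyclic_chain "Omega k N" "kernelT \<eta> N inp pol" phase "Suc (n + N)" good fresh
proof
  show "finite (Omega k N)" by (simp add: Omega_def)
next
  fix w w' assume "w \<in> Omega k N" "w' \<in> Omega k N"
  thus "0 \<le> kernelT \<eta> N inp pol w' w"
    by (auto simp: Omega_def kernel trans_nonneg dec_in_acts PU_nonneg eta)
next
  fix w assume "w \<in> Omega k N"
  then obtain s u q where w: "w = (s, u, q)" "s \<in> {0, 1}" "u < k" "q \<le> N"
    by (auto simp: Omega_def)
  have "(\<Sum>w'\<in>Omega k N. kernelT \<eta> N inp pol w' w)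
     = (\<Sum>s'\<in>{0, 1}. \<Sum>u'\<in>{0..<k}. \<Sum>q'\<in>{0..N}. if q' = gU N q (act_input (dec u') s)
     then trans (dec u') (dec u) q * PU \<eta> N (act_input (dec u') s) s q s' else 0)"
    unfolding sum_Omega w(1) using w(2) by (intro sum.cong refl kernel) auto
  also have "\<dots> = (\<Sum>s'\<in>{0, 1}. \<Sum>u'\<in>{0..<k}.
       trans (dec u') (dec u) q * PU \<eta> N (act_input (dec u') s) s q s')"
    by (simp add: sum.delta gU_le)
  also have "\<dots> = (\<Sum>u'\<in>{0..<k}. trans (dec u') (dec u) q)"
    by (simp add: PU_sum flip: sum.distrib distrib_left)
  also have "\<dots> = 1" using w by (simp add: sum_dec[of "\<lambda>a. trans a _ _"] trans_sum dec_in_acts)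
  finally show "(\<Sum>w'\<in>Omega k N. kernelT \<eta> N inp pol w' w) = 1" .
next
  fix w assume "w \<in> Omega k N"
  then obtain s u q where w: "w = (s, u, q)" "dec u \<in> acts"
    by (auto simp: Omega_def dec_in_acts)
  thus "phase w < Suc (n + N)" by (cases "dec u") (auto simp: phase_def hist_iff)
next
  fix w w' assume "w \<in> Omega k N" "w' \<in> Omega k N" "kernelT \<eta> N inp pol w' w \<noteq> 0"
  then obtain s u q s' u' q' where w: "w = (s, u, q)" "w' = (s', u', q')" "u < k" "u' < k"
    and "trans (dec u') (dec u) q \<noteq> 0"
    by (auto simp: Omega_def kernel split: if_splits)
  from trans_phase[OF dec_in_acts[OF w(3)] dec_in_acts[OF w(4)] this(5)]
  show "phase w' = (if Suc (phase w) = Suc (n + N) then 0 else Suc (phase w))"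
    unfolding w phase_def by simp
next
  fix w assume "w \<in> Omega k N" "phase w = 0"
  thus "good w" by (auto simp: phase_def good_def split: act.splits)
next
  fix w w' assume *: "w \<in> Omega k N" "w' \<in> Omega k N" "kernelT \<eta> N inp pol w' w \<noteq> 0"
    "good w" "phase w' \<noteq> 0"
  obtain s u q where w: "w = (s, u, q)" "s \<in> {0, 1}" "u < k" "q \<le> N"
    using * by (auto simp: Omega_def)
  obtain s' u' q' where w': "w' = (s', u', q')" "s' \<in> {0, 1}" "u' < k" "q' \<le> N"
    using * by (auto simp: Omega_def)
  have q': "q' = gU N q (act_input (dec u') s)" and tr: "trans (dec u') (dec u) q \<noteq> 0"
    and pu: "PU \<eta> N (act_input (dec u') s) s q s' \<noteq> 0"
    using *(3) w w' by (auto simp: kernel split: if_splits)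
  show "good w'"
  proof (cases "dec u'")
    case (Idle j')
    have "j' < N" using dec_in_acts[OF w'(3)] Idle by simp
    moreover have "j' \<le> q" using tr Idle *(4) w(1)
      by (cases "dec u") (auto simp: good_def split: if_splits)
    \<comment> \<open>A zero that leads to counter \<open>N\<close> was sent from counter
      \<open>N - 1\<close> or \<open>N\<close>, exactly where the modified law charges
      surely.\<close>
    moreover have "s' = 1" if "q' = N"
      using pu q' that Idle N w(4) by (auto simp: PU_def gU_def min_def split: if_splits)
    ultimately show ?thesis using q' Idle w'(1) by (auto simp: good_def gU_def)
  qed (auto simp: good_def w')
next
  fix w w' assume *: "w \<in> Omega k N" "w' \<in> Omega k N" "Suc (phase w) = Suc (n + N)" "good w"
    "phase w' = 0"
  obtain s u q where w: "w = (s, u, q)" "s \<in> {0, 1}" "u < k" "q \<le> N"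
    using * by (auto simp: Omega_def)
  obtain s' u' q' where w': "w' = (s', u', q')" "s' \<in> {0, 1}" "u' < k" "q' \<le> N"
    using * by (auto simp: Omega_def)
  \<comment> \<open>In the last phase \<open>good\<close> leaves only the counter \<open>N\<close>
    and a full battery, so the transition into \<open>Fire\<close> is the same for all these
    states.\<close>
  have "dec u = Idle (N - 1)"
    using *(3) w dec_in_acts[OF w(3)] N by (cases "dec u") (auto simp: phase_def hist_iff)
  moreover have "dec u' = Fire"
    using *(5) w' by (cases "dec u'") (auto simp: phase_def)
  moreover from calculation have "q = N" "s = 1"
    using *(4) w by (auto simp: good_def)
  ultimately show "kernelT \<eta> N inp pol w' w = fresh w'"
    using w w' N by (auto simp: kernel fresh_def gU_def PU_def behc_law_def)
next
  fix w assume "w \<in> Omega k N"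
  thus "0 \<le> fresh w" using eta by (cases w) (simp add: fresh_def)
next
  have "(\<Sum>w\<in>{w \<in> Omega k N. phase w = 0}. fresh w)
      = (\<Sum>w\<in>Omega k N. if phase w = 0 then fresh w else 0)"
    by (rule sum.inter_filter) (simp add: Omega_def)
  also have "\<dots> = (\<Sum>u\<in>{0..<k}. if act_phase n (dec u) = 0 then 1 else 0)"
  proof -
    have "(\<Sum>s\<in>{0, 1}. \<Sum>q\<in>{0..N}. if phase (s, u, q) = 0 then fresh (s, u, q) else 0) =
        (if act_phase n (dec u) = 0 then 1 else 0)" for u
      by (simp add: phase_def fresh_def sum.delta)
    thus ?thesis unfolding sum_Omega by (subst sum.swap) simp
  qed
  also have "\<dots> = 1"
    by (simp add: sum_dec[of "\<lambda>a. if act_phase n a = 0 then 1 else 0"] sum_acts)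
  finally show "(\<Sum>w\<in>{w \<in> Omega k N. phase w = 0}. fresh w) = 1" .
qed simp

lemma stationary_iff: "stationary \<eta> N k inp pol \<pi> \<longleftrightarrow> stat \<pi>"
  unfolding stationary_def stat_def ..

lemma stationary_ex1: "\<exists>!\<pi>. stationary \<eta> N k inp pol \<pi>"
  unfolding stationary_iff by (rule stat_ex1)

section \<open>The stationary law in terms of symbols\<close>

definition \<pi> :: "nat \<times> nat \<times> nat \<Rightarrow> real" where
  "\<pi> = (THE \<pi>. stationary \<eta> N k inp pol \<pi>)"

definition occ :: "nat \<Rightarrow> act \<Rightarrow> nat \<Rightarrow> real" where
  "occ s a q = \<pi> (s, the_inv_into {0..<k} dec a, q)"

text \<open>The stationary joint law of the newly drawn symbol with the battery and the counter
  before its input; the previous symbol is summed out.\<close>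

definition joint :: "act \<Rightarrow> nat \<Rightarrow> nat \<Rightarrow> real" where
  "joint a' s q = (\<Sum>a\<in>acts. occ s a q * trans a' a q)"

lemma stat_\<pi>: "stat \<pi>"
  using theI'[OF stationary_ex1] unfolding \<pi>_def stationary_iff .

lemma \<pi>_nonneg: "w \<in> Omega k N \<Longrightarrow> 0 \<le> \<pi> w"
  using stat_\<pi> unfolding stat_def by blast

lemma \<pi>_step: "w' \<in> Omega k N \<Longrightarrow> \<pi> w' = (\<Sum>w\<in>Omega k N. \<pi> w * kernelT \<eta> N inp pol w' w)"
  using stat_\<pi> unfolding stat_def by blast

lemma occ_dec: "u < k \<Longrightarrow> occ s (dec u) q = \<pi> (s, u, q)"
  using the_inv_into_f_f[of dec "{0..<k}" u] bij_dec by (simp add: occ_def bij_betw_def)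

lemma acts_dec:
  assumes "a \<in> acts" obtains u where "u < k" "a = dec u"
  using assms bij_dec by (force simp: bij_betw_def)

lemma occ_nonneg:
  assumes "a \<in> acts" "s \<in> {0, 1}" "q \<le> N"
  shows "0 \<le> occ s a q"
proof -
  obtain u where "u < k" "a = dec u" using assms(1) by (rule acts_dec)
  thus ?thesis using \<pi>_nonneg[of "(s, u, q)"] assms(2,3) by (auto simp: occ_dec Omega_def)
qed

lemma joint_nonneg: "a \<in> acts \<Longrightarrow> s \<in> {0, 1} \<Longrightarrow> q \<le> N \<Longrightarrow> 0 \<le> joint a s q"
  unfolding joint_def by (intro sum_nonneg mult_nonneg_nonneg occ_nonneg trans_nonneg)

lemma joint_dec: "joint a' s q = (\<Sum>u\<in>{0..<k}. \<pi> (s, u, q) * trans a' (dec u) q)"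
  unfolding joint_def sum_dec[symmetric] by (intro sum.cong refl) (simp add: occ_dec)

lemma occ_step:
  assumes "a' \<in> acts" "s' \<in> {0, 1}" "q' \<le> N"
  shows "occ s' a' q' = (\<Sum>s\<in>{0, 1}. \<Sum>q\<in>{0..N}.
    if q' = gU N q (act_input a' s) then joint a' s q * PU \<eta> N (act_input a' s) s q s' else 0)"
proof -
  obtain u' where u': "u' < k" "a' = dec u'" using assms(1) by (rule acts_dec)
  have "(s', u', q') \<in> Omega k N" using assms u' by (auto simp: Omega_def)
  hence "occ s' a' q' = (\<Sum>w\<in>Omega k N. \<pi> w * kernelT \<eta> N inp pol (s', u', q') w)"
    unfolding u'(2) occ_dec[OF u'(1)] by (rule \<pi>_step)
  also have "\<dots> = (\<Sum>s\<in>{0, 1}. \<Sum>u\<in>{0..<k}. \<Sum>q\<in>{0..N}. \<pi> (s, u, q) * (if q' = gU N q (act_input a' s)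
     then trans a' (dec u) q * PU \<eta> N (act_input a' s) s q s' else 0))"
    unfolding sum_Omega u'(2)
    by (intro sum.cong refl arg_cong2[where f = "(*)"] kernel u'(1)) auto
  also have "\<dots> = (\<Sum>s\<in>{0, 1}. \<Sum>q\<in>{0..N}. \<Sum>u\<in>{0..<k}. \<pi> (s, u, q) * (if q' = gU N q (act_input a' s)
     then trans a' (dec u) q * PU \<eta> N (act_input a' s) s q s' else 0))"
    by (intro sum.cong[OF refl] sum.swap)
  also have "\<dots> = (\<Sum>s\<in>{0, 1}. \<Sum>q\<in>{0..N}.
    if q' = gU N q (act_input a' s) then joint a' s q * PU \<eta> N (act_input a' s) s q s' else 0)"
    unfolding joint_dec sum_distrib_right
    by (intro sum.cong[OF refl]) (auto intro!: sum.cong)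
  finally show ?thesis .
qed

lemma occ_Fire:
  assumes "s \<in> {0, 1}" "q \<le> N"
  shows "occ s Fire q = (if q = 0 then (if s = 1 then \<eta> else 1 - \<eta>) / real (Suc (n + N)) else 0)"
proof -
  obtain u where u: "u < k" "Fire = dec u" using Fire_in_acts by (rule acts_dec)
  have "\<pi> (s, u, q) = fresh (s, u, q) / real (Suc (n + N))"
    using u assms by (intro stat_0[OF stat_\<pi>]) (auto simp: Omega_def phase_def simp flip: u(2))
  thus ?thesis using occ_dec[OF u(1), of s q] by (simp add: fresh_def flip: u(2))
qed

text \<open>\<open>Fire\<close> follows only \<open>Idle (N - 1)\<close>, where stationary mass sits
  on good states and hence on full batteries. So \<open>Fire\<close> always sends a one.\<close>

lemma joint_Fire_0:
  assumes "q \<le> N"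
  shows "joint Fire 0 q = 0"
  unfolding joint_def
proof (intro sum.neutral ballI)
  fix a assume a: "a \<in> acts"
  obtain u where u: "u < k" "a = dec u" using a by (rule acts_dec)
  show "occ 0 a q * trans Fire a q = 0"
  proof (cases a)
    case (Idle j)
    have "occ 0 a q = 0" if "Suc j = N"
    proof (rule ccontr)
      assume "occ 0 a q \<noteq> 0"
      hence "good (0, u, q)"
        using u assms by (intro stat_good[OF stat_\<pi>]) (auto simp: occ_dec Omega_def)
      thus False using Idle u assms that by (auto simp: good_def split: act.splits)
    qed
    thus ?thesis using Idle a by auto
  qed auto
qed

definition battery :: "nat \<Rightarrow> nat list \<Rightarrow> nat \<Rightarrow> real" where
  "battery m xs s = (if s = 1 then V m xs else W m xs - V m xs)"

text \<open>The ratio in \<open>strategy_law\<close> cancels against the weight of the full battery.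
  In the degenerate case \<open>V m xs = 0\<close>, \<open>V_ge\<close> forces
  \<open>W m (xs @ [1]) = 0\<close> as well.\<close>

lemma strategy_battery:
  assumes "m \<in> {1..M}" "xs \<in> hist"
  shows "strategy_law m xs (Suc 0) * battery m xs (Suc 0) = W m (xs @ [1])"
    "strategy_law m xs 0 * battery m xs (Suc 0) = V m xs - W m (xs @ [1])"
proof -
  show 1: "strategy_law m xs (Suc 0) * battery m xs (Suc 0) = W m (xs @ [1])"
    using W_nonneg[OF assms(1), of "xs @ [1]"] V_ge[OF assms(1) histD[OF assms(2)]]
    by (cases "V m xs = 0") (auto simp: strategy_law_def battery_def)
  have "strategy_law m xs 0 = 1 - strategy_law m xs (Suc 0)"
    using strategy_law_sum[of m xs] by simp
  thus "strategy_law m xs 0 * battery m xs (Suc 0) = V m xs - W m (xs @ [1])"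
    using 1 by (simp add: left_diff_distrib) (simp add: battery_def)
qed

lemma strategy_battery_0:
  "strategy_law m xs 0 * battery m xs 0 + strategy_law m xs (Suc 0) * battery m xs 0
    = W m xs - V m xs"
  using strategy_law_sum[of m xs] by (simp add: battery_def flip: distrib_right)

text \<open>Because \<open>N \<ge> 1\<close>, the counter is zero exactly after an input 1, so it reveals the last input.\<close>
lemma battery_snoc:
  assumes m: "m \<in> {1..M}" and xs: "xs \<in> hist" and s': "s' \<in> {0, 1}" and y: "y \<in> {0, 1}"
  shows "(if y = (if q' = 0 then 1 else 0) then \<Sum>t\<in>{0, 1}. \<Sum>s\<in>{0, 1}.
      (if q' = gU N (q_after N xs) (t * s)
       then strategy_law m xs t * battery m xs s * PU \<eta> N (t * s) s (q_after N xs) s' else 0) else 0)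
    = (if q' = q_after N (xs @ [y]) then battery m (xs @ [y]) s' else 0)"
proof -
  let ?q = "q_after N xs"
  note h = m histD[OF xs]
  note wb = strategy_battery[OF m xs] strategy_battery_0[of m xs]
  have g0: "gU N ?q 0 \<noteq> 0" and g1: "gU N ?q (Suc 0) = 0" using N by (auto simp: gU_def)
  show ?thesis
  proof (cases "y = 1")
    case True
    have "PU \<eta> N 1 1 ?q s' = (if s' = 1 then \<eta> else 1 - \<eta>)"
      using s' by (auto simp: PU_def behc_law_def)
    thus ?thesis using True g0 g1 wb(1) V_one[OF h]
      by (auto simp: q_after_snoc battery_def[of _ "xs @ [_]"] algebra_simps)
  next
    case False
    hence y0: "y = 0" using y by auto
    have split: "W m xs = W m (xs @ [0]) + W m (xs @ [1])" by (rule W_split[OF h])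
    \<comment> \<open>An input 0 arises in three ways: bit 0 with either battery state, or bit 1
      with an empty battery. Together they give the idle recursion for \<open>V\<close>.\<close>
    have "strategy_law m xs 0 * battery m xs 0 * PU \<eta> N 0 0 ?q s'
        + strategy_law m xs 0 * battery m xs (Suc 0) * PU \<eta> N 0 (Suc 0) ?q s'
        + strategy_law m xs (Suc 0) * battery m xs 0 * PU \<eta> N 0 0 ?q s'
        = (W m xs - V m xs) * PU \<eta> N 0 0 ?q s' + (V m xs - W m (xs @ [1])) * PU \<eta> N 0 (Suc 0) ?q s'"
      unfolding wb(2) wb(3)[symmetric] by (simp add: algebra_simps)
    also have "\<dots> = battery m (xs @ [0]) s'"
      using s' unfolding split
      by (auto simp: battery_def V_idle[OF h] charge_idle_def PU_def behc_law_def algebra_simps)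
    finally show ?thesis using y0 g0 g1 by (auto simp: q_after_snoc)
  qed
qed

lemma trans_Code_Idle [simp]: "trans (Code m xs t) (Idle j) q = 0"
  by simp

lemma trans_Code_Nil_Code [simp]: "trans (Code m [] t) (Code m' xs t') q = 0"
  by auto

lemma joint_Code_Nil:
  assumes "m \<in> {1..M}"
  shows "joint (Code m [] t) s q = occ s Fire q * (strategy_law m [] t / real M)"
  unfolding joint_def sum_acts trans_Code_Idle trans_Code_Nil_Code by simp

lemma joint_Code_snoc:
  assumes "m \<in> {1..M}" "xs \<in> hist" "Suc (length xs) < n"
  shows "joint (Code m (xs @ [y]) t) s q = (if y = (if q = 0 then 1 else 0)
     then (\<Sum>t'\<in>{0, 1}. occ s (Code m xs t') q) * strategy_law m (xs @ [y]) t else 0)"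
proof -
  define g where "g = (if y = (if q = 0 then 1 else 0)
     then (\<Sum>t'\<in>{0, 1}. occ s (Code m xs t') q) * strategy_law m (xs @ [y]) t else 0)"
  have inner: "(\<Sum>t'\<in>{0, 1}. occ s (Code m' xs' t') q * trans (Code m (xs @ [y]) t) (Code m' xs' t') q)
     = (if m' = m \<and> xs' = xs then g else 0)" for m' xs'
    using assms(3) by (auto simp: g_def distrib_right)
  have "joint (Code m (xs @ [y]) t) s q =
     (\<Sum>m'\<in>{1..M}. \<Sum>xs'\<in>hist. if m' = m \<and> xs' = xs then g else 0)"
    unfolding joint_def sum_acts inner trans_Code_Idle by simp
  also have "\<dots> = g" by (rule sum_of_bool_pair) (use assms in auto)
  finally show ?thesis unfolding g_def .
qed

text \<open>Given message and past inputs, the counter is determined and the bit is independent of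
  the battery, whose weights follow the recursion for \<open>V\<close>. The induction over the
  history combines \<open>occ_step\<close> with \<open>battery_snoc\<close>. The constant is the
  uniform message law times the mass \<open>1 / (n + N + 1)\<close> of one phase.\<close>

lemma joint_Code:
  assumes "m \<in> {1..M}" "xs \<in> hist" "t \<in> {0, 1}" "s \<in> {0, 1}" "q \<le> N"
  shows "joint (Code m xs t) s q = (if q = q_after N xs
    then strategy_law m xs t * battery m xs s / (real M * real (Suc (n + N))) else 0)"
  using assms(2-)
proof (induction xs arbitrary: t s q rule: rev_induct)
  case Nil
  have "battery m [] s = (if s = 1 then \<eta> else 1 - \<eta>)"
    using W_Nil[OF assms(1)] V_Nil[OF assms(1)] by (simp add: battery_def)
  thus ?case using Nil assms(1) unfolding joint_Code_Nil[OF assms(1)]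
    by (simp add: occ_Fire ac_simps del: of_nat_Suc)
next
  case (snoc y xs t' s' q')
  let ?c = "real M * real (Suc (n + N))" and ?q = "q_after N xs"
  have xs: "xs \<in> hist" "Suc (length xs) < n" and y: "y \<in> {0, 1}"
    using snoc.prems(1) by (auto simp: hist_iff)
  have occ: "occ s' (Code m xs t) q' = (\<Sum>s\<in>{0, 1}. if q' = gU N ?q (t * s)
       then strategy_law m xs t * battery m xs s * PU \<eta> N (t * s) s ?q s' else 0) / ?c"
    if t: "t \<in> {0, 1}" for t
  proof -
    have "occ s' (Code m xs t) q' = (\<Sum>s\<in>{0, 1}. \<Sum>q\<in>{0..N}.
      if q' = gU N q (t * s) then joint (Code m xs t) s q * PU \<eta> N (t * s) s q s' else 0)"
      by (rule occ_step[of "Code m xs t" s' q', unfolded act_input.simps])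
         (use assms(1) xs t snoc.prems in auto)
    also have "\<dots> = (\<Sum>s\<in>{0, 1}. \<Sum>q\<in>{0..N}. if q = ?q then (if q' = gU N ?q (t * s)
       then strategy_law m xs t * battery m xs s * PU \<eta> N (t * s) s ?q s' else 0) / ?c else 0)"
      by (intro sum.cong refl) (use snoc.IH xs(1) t in auto)
    also have "\<dots> = (\<Sum>s\<in>{0, 1}. (if q' = gU N ?q (t * s)
       then strategy_law m xs t * battery m xs s * PU \<eta> N (t * s) s ?q s' else 0) / ?c)"
      using q_after_le[of N xs] by (intro sum.cong refl) (subst sum.delta, auto)
    finally show ?thesis unfolding sum_divide_distrib .
  qed
  have "joint (Code m (xs @ [y]) t') s' q' = (if y = (if q' = 0 then 1 else 0)
     then (\<Sum>t\<in>{0, 1}. occ s' (Code m xs t) q') * strategy_law m (xs @ [y]) t' else 0)"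
    by (rule joint_Code_snoc[OF assms(1) xs])
  also have "(\<Sum>t\<in>{0, 1}. occ s' (Code m xs t) q') = (\<Sum>t\<in>{0, 1}. \<Sum>s\<in>{0, 1}. if q' = gU N ?q (t * s)
       then strategy_law m xs t * battery m xs s * PU \<eta> N (t * s) s ?q s' else 0) / ?c"
    unfolding sum_divide_distrib[of _ "{0, 1} :: nat set"] by (intro sum.cong refl) (simp only: occ sum_divide_distrib)
  also have "(if y = (if q' = 0 then 1 else 0) then \<dots> * strategy_law m (xs @ [y]) t' else 0)
     = (if y = (if q' = 0 then 1 else 0) then \<Sum>t\<in>{0, 1}. \<Sum>s\<in>{0, 1}. if q' = gU N ?q (t * s)
       then strategy_law m xs t * battery m xs s * PU \<eta> N (t * s) s ?q s' else 0 else 0)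
       * strategy_law m (xs @ [y]) t' / ?c"
    by simp
  also have "\<dots> = (if q' = q_after N (xs @ [y]) then battery m (xs @ [y]) s' else 0)
       * strategy_law m (xs @ [y]) t' / ?c"
    unfolding battery_snoc[OF assms(1) xs(1) snoc.prems(3) y] ..
  finally show ?case by (simp add: mult.commute)
qed

section \<open>Inputs produced by the policy and the test law\<close>

definition out :: "act \<Rightarrow> nat \<Rightarrow> nat \<Rightarrow> real" where
  "out a x q = (\<Sum>s\<in>{0, 1}. if x = act_input a s then joint a s q else 0)"

lemma out_nonneg: "a \<in> acts \<Longrightarrow> q \<le> N \<Longrightarrow> 0 \<le> out a x q"
  unfolding out_def by (intro sum_nonneg) (auto intro: joint_nonneg)

text \<open>Averaging over the bit makes \<open>V\<close> cancel, and the policy reproduces the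
  input law of the code.\<close>

lemma out_Code:
  assumes "m \<in> {1..M}" "xs \<in> hist" "x \<in> {0, 1}" "q \<le> N"
  shows "(\<Sum>t\<in>{0, 1}. out (Code m xs t) x q) =
    (if q = q_after N xs then W m (xs @ [x]) / (real M * real (Suc (n + N))) else 0)"
proof -
  have split: "W m xs = W m (xs @ [0]) + W m (xs @ [1])"
    by (rule W_split[OF assms(1) histD[OF assms(2)]])
  note wb = strategy_battery[OF assms(1,2)] strategy_battery_0[of m xs]
  have "(\<Sum>t\<in>{0, 1}. out (Code m xs t) x q) = (if q = q_after N xs then
     (\<Sum>t\<in>{0, 1}. \<Sum>s\<in>{0, 1}. if x = t * s then strategy_law m xs t * battery m xs s else 0) 
      / (real M * real (Suc (n + N))) else 0)"
    using assms by (simp add: out_def joint_Code add_divide_distrib)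
  also have "(\<Sum>t\<in>{0, 1}. \<Sum>s\<in>{0, 1}. if x = t * s then strategy_law m xs t * battery m xs s else 0)
     = W m (xs @ [x])"
    using assms(3) wb split by auto
  finally show ?thesis .
qed

text \<open>The test law for \<open>cond_mi_ge\<close>. On code symbols it is the conditional input
  law of the code and ignores the bit \<open>t\<close>, so that \<open>out_Code\<close> applies to
  the sum over \<open>t\<close>; idle and firing inputs are certain.\<close>

fun prediction :: "act \<Rightarrow> nat \<Rightarrow> real" where
  "prediction (Idle j) x = (if x = 0 then 1 else 0)"
| "prediction Fire x = (if x = 1 then 1 else 0)"
| "prediction (Code m xs t) x = W m (xs @ [x]) / W m xs"

lemma prediction_nonneg: "a \<in> acts \<Longrightarrow> 0 \<le> prediction a x"
  by (cases a) (auto simp: W_nonneg)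

lemma prediction_sum:
  assumes "a \<in> acts"
  shows "(\<Sum>x\<in>{0, 1}. prediction a x) \<le> 1"
proof (cases a)
  case (Code m xs t)
  hence "m \<in> {1..M}" "xs \<in> hist" using assms by auto
  hence "W m xs = W m (xs @ [0]) + W m (xs @ [1])" using W_split histD by blast
  thus ?thesis using Code by (cases "W m xs = 0") (simp_all flip: add_divide_distrib)
qed simp_all

lemma W_snoc_le:
  assumes "m \<in> {1..M}" "xs \<in> hist" "x \<in> {0, 1}"
  shows "W m (xs @ [x]) \<le> W m xs"
  using W_split[OF assms(1) histD[OF assms(2)]] W_nonneg[OF assms(1)] assms(3) by fastforce

lemma out_Idle: "out (Idle j) (Suc 0) q = 0"
  by (simp add: out_def)

lemma out_Fire: "q \<le> N \<Longrightarrow> out Fire 0 q = 0"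
  by (simp add: out_def joint_Fire_0)

lemma prediction_pos:
  assumes a: "a \<in> acts" and x: "x \<in> {0, 1}" and q: "q \<le> N" and pos: "out a x q > 0"
  shows "prediction a x > 0"
proof (cases a)
  case (Idle j)
  hence "x \<noteq> Suc 0" using pos by (auto simp: out_Idle)
  thus ?thesis using Idle x by auto
next
  case Fire
  hence "x \<noteq> 0" using pos q by (metis out_Fire less_irrefl)
  thus ?thesis using Fire x by auto
next
  case (Code m xs t)
  hence *: "m \<in> {1..M}" "xs \<in> hist" "t \<in> {0, 1}" using a by auto
  have "out a x q \<le> (\<Sum>t\<in>{0, 1}. out (Code m xs t) x q)"
    unfolding Code using * q by (intro member_le_sum out_nonneg) auto
  hence "(\<Sum>t\<in>{0, 1}. out (Code m xs t) x q) > 0" using pos by linarith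
  hence "W m (xs @ [x]) \<noteq> 0" using out_Code[OF *(1,2) x q] by (auto split: if_splits)
  hence "W m (xs @ [x]) > 0" using W_nonneg[OF *(1), of "xs @ [x]"] by linarith
  thus ?thesis using W_snoc_le[OF *(1,2) x] Code by simp
qed

section \<open>Mutual information of the block policy\<close>

definition law_uux :: "nat \<times> nat \<Rightarrow> nat \<Rightarrow> nat \<Rightarrow> real" where
  "law_uux = joint_uux_q \<eta> N inp pol \<pi>"

lemma law_uux:
  "law_uux (u', u) x q = (\<Sum>s\<in>{0, 1}. if x = act_input (dec u') s
     then \<pi> (s, u, q) * trans (dec u') (dec u) q else 0)"
proof -
  have q': "(\<Sum>q'\<in>{0..N}. if q' = gU N q x then 1 else 0) = (1 :: real)"
    by (simp add: sum.delta gU_le)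
  have s': "(\<Sum>s'\<in>{0, 1}. PU \<eta> N x s q s') = 1" for s by (simp add: PU_sum)
  have "law_uux (u', u) x q = (\<Sum>s\<in>{0, 1}. \<pi> (s, u, q) * pol u' u q * (if x = inp u' s then 1 else 0))"
    unfolding law_uux_def joint_uux_q_def prod.case
    by (simp only: sum_distrib_left[symmetric] q' s' mult_1_right)
  also have "\<dots> = (\<Sum>s\<in>{0, 1}. if x = act_input (dec u') s
     then \<pi> (s, u, q) * trans (dec u') (dec u) q else 0)"
    unfolding pol_def inp_def by (intro sum.cong refl) simp
  finally show ?thesis .
qed

lemma law_uux_nonneg: "u < k \<Longrightarrow> u' < k \<Longrightarrow> q \<le> N \<Longrightarrow> 0 \<le> law_uux (u', u) x q"
  unfolding law_uux
  by (intro sum_nonneg) (auto intro!: mult_nonneg_nonneg \<pi>_nonneg trans_nonneg dec_in_acts simp: Omega_def)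

lemma sum_law_uux: "(\<Sum>u\<in>{0..<k}. law_uux (u', u) x q) = out (dec u') x q"
  unfolding law_uux out_def joint_dec
  by (subst sum.swap) (intro sum.cong refl, auto)

lemma sum_law_uux_pairs:
  fixes g :: "act \<Rightarrow> real"
  shows "(\<Sum>uu\<in>{0..<k} \<times> {0..<k}. law_uux uu x q * g (dec (fst uu))) = (\<Sum>a\<in>acts. out a x q * g a)"
proof -
  have "(\<Sum>uu\<in>{0..<k} \<times> {0..<k}. law_uux uu x q * g (dec (fst uu)))
      = (\<Sum>u'\<in>{0..<k}. (\<Sum>u\<in>{0..<k}. law_uux (u', u) x q) * g (dec u'))"
    unfolding sum_distrib_right sum.cartesian_product by (simp add: case_prod_unfold)
  also have "\<dots> = (\<Sum>a\<in>acts. out a x q * g a)"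
    unfolding sum_law_uux by (rule sum_dec)
  finally show ?thesis .
qed

text \<open>The stationary conditional law of the input given the counter. At a counter of mass zero
  it vanishes by the convention for division, so it is only substochastic in general.\<close>

definition output_law :: "nat \<Rightarrow> nat \<Rightarrow> real" where
  "output_law x q = (\<Sum>uu\<in>{0..<k} \<times> {0..<k}. law_uux uu x q) /
     (\<Sum>uu\<in>{0..<k} \<times> {0..<k}. \<Sum>x\<in>{0, 1}. law_uux uu x q)"

lemma output_law_nonneg: "q \<le> N \<Longrightarrow> 0 \<le> output_law x q"
  unfolding output_law_def by (auto intro!: divide_nonneg_nonneg sum_nonneg add_nonneg_nonneg law_uux_nonneg)

lemma output_law_sum: "output_law 0 q + output_law (Suc 0) q \<le> 1"
  by (simp add: output_law_def sum.distrib flip: add_divide_distrib)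

lemma output_law_le: "q \<le> N \<Longrightarrow> x \<in> {0, 1} \<Longrightarrow> output_law x q \<le> 1"
  using output_law_sum[of q] output_law_nonneg[of q 0] output_law_nonneg[of q "Suc 0"] by auto

lemma log_inverse_output_law: "q \<le> N \<Longrightarrow> x \<in> {0, 1} \<Longrightarrow> 0 \<le> log 2 (1 / output_law x q)"
  using output_law_le[of q x] output_law_nonneg[of q x]
  by (cases "output_law x q = 0") (auto simp: log_def field_simps)

lemma output_law_pos:
  assumes "m \<in> {1..M}" "xs \<in> hist" "x \<in> {0, 1}" "W m (xs @ [x]) > 0"
  shows "output_law x (q_after N xs) > 0"
proof -
  let ?q = "q_after N xs" and ?A = "{0..<k} \<times> {0..<k}"
  have q: "?q \<le> N" by (rule q_after_le)
  have "(\<Sum>t\<in>{0, 1}. out (Code m xs t) x ?q) > 0"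
    using out_Code[OF assms(1-3) q] assms(4) M by simp
  then obtain t where t: "t \<in> {0, 1}" "out (Code m xs t) x ?q > 0"
    by (metis (no_types, lifting) not_less sum_nonpos)
  have "out (Code m xs t) x ?q \<le> (\<Sum>a\<in>acts. out a x ?q)"
    using assms t q by (intro member_le_sum[of _ _ "\<lambda>a. out a x ?q"] out_nonneg) auto
  hence num: "(\<Sum>uu\<in>?A. law_uux uu x ?q) > 0"
    using sum_law_uux_pairs[of x ?q "\<lambda>_. 1"] t(2) by simp
  also have "(\<Sum>uu\<in>?A. law_uux uu x ?q) \<le> (\<Sum>uu\<in>?A. \<Sum>x\<in>{0, 1}. law_uux uu x ?q)"
    using assms(3) q by (intro sum_mono member_le_sum) (auto intro: law_uux_nonneg)
  finally show ?thesis using num by (simp add: output_law_def)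
qed

text \<open>\<open>cond_mi_ge\<close> applied to \<open>prediction\<close>: idle and firing symbols
  have certain inputs and contribute nonnegative terms, which are dropped. A history
  \<open>xs\<close> of message \<open>m\<close> contributes its one-step divergence divided by
  \<open>M * (n + N + 1)\<close>.\<close>

lemma cond_mi_ge_code_divergence:
  "(\<Sum>m\<in>{1..M}. \<Sum>xs\<in>hist. \<Sum>x\<in>{0, 1}. W m (xs @ [x]) *
      log 2 (W m (xs @ [x]) / W m xs / output_law x (q_after N xs))) / real M
   \<le> real (Suc (n + N)) * cond_mi ({0..<k} \<times> {0..<k}) {0, 1} {0..N} law_uux"
proof -
  let ?A = "{0..<k} \<times> {0..<k}" and ?c = "real M * real (Suc (n + N))"
  define h where "h a = (\<Sum>x\<in>{0, 1}. \<Sum>q\<in>{0..N}. out a x q * log 2 (prediction a x / output_law x q))" for a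
  have idle: "0 \<le> h (Idle j)" if "j < N" for j
    unfolding h_def using that
    by (auto simp: out_Idle intro!: sum_nonneg mult_nonneg_nonneg out_nonneg log_inverse_output_law)
  have fire: "0 \<le> h Fire"
    unfolding h_def
    by (auto simp: out_Fire intro!: sum_nonneg mult_nonneg_nonneg out_nonneg log_inverse_output_law)
  have code: "(\<Sum>t\<in>{0, 1}. h (Code m xs t)) = (\<Sum>x\<in>{0, 1}. W m (xs @ [x]) *
      log 2 (W m (xs @ [x]) / W m xs / output_law x (q_after N xs))) / ?c"
    if "m \<in> {1..M}" "xs \<in> hist" for m xs
  proof -
    let ?l = "\<lambda>x q. log 2 (W m (xs @ [x]) / W m xs / output_law x q)"
    have "(\<Sum>t\<in>{0, 1}. h (Code m xs t)) = (\<Sum>x\<in>{0, 1}. \<Sum>t\<in>{0, 1}. \<Sum>q\<in>{0..N}.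
        out (Code m xs t) x q * ?l x q)"
      unfolding h_def prediction.simps by (rule sum.swap)
    also have "\<dots> = (\<Sum>x\<in>{0, 1}. \<Sum>q\<in>{0..N}. (\<Sum>t\<in>{0, 1}. out (Code m xs t) x q) * ?l x q)"
      unfolding sum_distrib_right by (intro sum.cong[OF refl] sum.swap)
    also have "\<dots> = (\<Sum>x\<in>{0, 1}. \<Sum>q\<in>{0..N}. if q = q_after N xs then W m (xs @ [x]) * ?l x q / ?c else 0)"
    proof (intro sum.cong refl)
      fix x q assume "x \<in> {0, 1 :: nat}" "q \<in> {0..N}"
      thus "(\<Sum>t\<in>{0, 1}. out (Code m xs t) x q) * ?l x q =
          (if q = q_after N xs then W m (xs @ [x]) * ?l x q / ?c else 0)"
        by (subst out_Code[OF that]) auto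
    qed
    also have "\<dots> = (\<Sum>x\<in>{0, 1}. W m (xs @ [x]) * ?l x (q_after N xs) / ?c)"
      using q_after_le[of N xs] by (intro sum.cong refl) (subst sum.delta, auto)
    finally show ?thesis by (simp only: sum_divide_distrib)
  qed
  have "(\<Sum>m\<in>{1..M}. \<Sum>xs\<in>hist. \<Sum>x\<in>{0, 1}. W m (xs @ [x]) *
      log 2 (W m (xs @ [x]) / W m xs / output_law x (q_after N xs))) / ?c
    = (\<Sum>m\<in>{1..M}. \<Sum>xs\<in>hist. \<Sum>t\<in>{0, 1}. h (Code m xs t))"
    unfolding sum_divide_distrib[of _ "{1..M}"] sum_divide_distrib[of _ hist]
    by (intro sum.cong refl code[symmetric])
  also have "\<dots> \<le> (\<Sum>a\<in>acts. h a)"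
    unfolding sum_acts using fire idle by (auto intro!: add_nonneg_nonneg sum_nonneg)
  also have "\<dots> = (\<Sum>x\<in>{0, 1}. \<Sum>q\<in>{0..N}. \<Sum>a\<in>acts. out a x q * log 2 (prediction a x / output_law x q))"
    unfolding h_def by (subst sum.swap) (intro sum.cong[OF refl] sum.swap)
  also have "\<dots> = (\<Sum>x\<in>{0, 1}. \<Sum>q\<in>{0..N}. \<Sum>uu\<in>?A. law_uux uu x q *
      log 2 (prediction (dec (fst uu)) x / output_law x q))"
    by (simp only: sum_law_uux_pairs[of _ _ "\<lambda>a. log 2 (prediction a _ / output_law _ _)"])
  also have "\<dots> = (\<Sum>x\<in>{0, 1}. \<Sum>uu\<in>?A. \<Sum>q\<in>{0..N}. law_uux uu x q *
      log 2 (prediction (dec (fst uu)) x / output_law x q))"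
    by (intro sum.cong[OF refl] sum.swap)
  also have "\<dots> = (\<Sum>uu\<in>?A. \<Sum>x\<in>{0, 1}. \<Sum>q\<in>{0..N}. law_uux uu x q *
      log 2 (prediction (dec (fst uu)) x / output_law x q))"
    by (rule sum.swap)
  also have "\<dots> \<le> cond_mi ?A {0, 1} {0..N} law_uux"
    unfolding output_law_def
  \<comment> \<open>The test law depends on the pair of auxiliary symbols only through the new one,
    so positivity can be checked after summing out the old one.\<close>
  proof (rule cond_mi_ge[where \<rho> = "\<lambda>uu x q. prediction (dec (fst uu)) x"])
    fix uu x q assume "uu \<in> ?A" "x \<in> {0, 1 :: nat}" "q \<in> {0..N}" and pos: "law_uux uu x q > 0"
    then obtain u u' where u: "uu = (u', u)" "u < k" "u' < k" "q \<le> N" "x \<in> {0, 1}" by auto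
    have "law_uux (u', u) x q \<le> (\<Sum>u\<in>{0..<k}. law_uux (u', u) x q)"
      using u by (intro member_le_sum[of u _ "\<lambda>u. law_uux (u', u) x q"] law_uux_nonneg) auto
    hence "out (dec u') x q > 0" using pos u by (simp add: sum_law_uux)
    thus "prediction (dec (fst uu)) x > 0" using u by (auto intro!: prediction_pos dec_in_acts)
  qed (auto intro!: law_uux_nonneg prediction_nonneg dec_in_acts
         prediction_sum[simplified])
  finally have le: "(\<Sum>m\<in>{1..M}. \<Sum>xs\<in>hist. \<Sum>x\<in>{0, 1}. W m (xs @ [x]) *
      log 2 (W m (xs @ [x]) / W m xs / output_law x (q_after N xs))) / ?c
    \<le> cond_mi ?A {0, 1} {0..N} law_uux" .
  have "a / b \<le> c * d" if "a / (b * c) \<le> d" "b > 0" "c > 0" for a b c d :: real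
    using that by (simp add: field_simps)
  from this[OF le] show ?thesis using M by simp
qed

end

section \<open>Divergence of a code from a path measure\<close>

text \<open>A measure on input sequences in which the past acts only through the counter. It is the
  same for all messages, so it can serve as \<open>G\<close> in
  \<open>fano_change_of_measure\<close>.\<close>

definition path_weight :: "(nat \<Rightarrow> nat \<Rightarrow> real) \<Rightarrow> nat \<Rightarrow> nat list \<Rightarrow> real" where
  "path_weight r N xs = (\<Prod>i<length xs. r (xs ! i) (q_after N (take i xs)))"

lemma path_weight_Nil [simp]: "path_weight r N [] = 1"
  by (simp add: path_weight_def)

lemma path_weight_snoc: "path_weight r N (xs @ [x]) = path_weight r N xs * r x (q_after N xs)"
  by (simp add: path_weight_def nth_append)

lemma path_weight_nonneg:
  assumes "\<And>x q. q \<le> N \<Longrightarrow> 0 \<le> r x q"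
  shows "0 \<le> path_weight r N xs"
  unfolding path_weight_def using assms q_after_le by (intro prod_nonneg) auto

lemma path_weight_sum:
  assumes r: "\<And>x q. q \<le> N \<Longrightarrow> 0 \<le> r x q" and r_sum: "\<And>q. r 0 q + r 1 q \<le> 1"
  shows "(\<Sum>xs\<in>state_seqs i. path_weight r N xs) \<le> 1"
proof (induction i)
  case (Suc i)
  have "(\<Sum>xs\<in>state_seqs (Suc i). path_weight r N xs)
      = (\<Sum>xs\<in>state_seqs i. path_weight r N xs * (r 0 (q_after N xs) + r 1 (q_after N xs)))"
    by (simp add: sum_state_seqs_Suc path_weight_snoc distrib_left)
  also have "\<dots> \<le> (\<Sum>xs\<in>state_seqs i. path_weight r N xs)"
    using r_sum path_weight_nonneg[OF r] by (intro sum_mono mult_left_le) auto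
  finally show ?case using Suc by linarith
qed simp

context
  fixes W :: "nat list \<Rightarrow> real" and n :: nat
  assumes W_Nil: "W [] = 1" and W_nonneg: "\<And>xs. 0 \<le> W xs"
    and W_split: "\<And>xs i. xs \<in> state_seqs i \<Longrightarrow> i < n \<Longrightarrow> W xs = W (xs @ [0]) + W (xs @ [1])"
begin

lemma split_law_sum: "i \<le> n \<Longrightarrow> (\<Sum>xs\<in>state_seqs i. W xs) = 1"
proof (induction i)
  case (Suc i)
  have "(\<Sum>xs\<in>state_seqs (Suc i). W xs) = (\<Sum>xs\<in>state_seqs i. W xs)"
    unfolding sum_state_seqs_Suc by (intro sum.cong refl) (use W_split Suc.prems in simp)
  thus ?case using Suc by simp
qed (simp add: W_Nil)

context
  fixes r :: "nat \<Rightarrow> nat \<Rightarrow> real" and N :: nat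
  assumes r_pos: "\<And>xs i x. xs \<in> state_seqs i \<Longrightarrow> i < n \<Longrightarrow> x \<in> {0, 1} \<Longrightarrow> W (xs @ [x]) > 0 \<Longrightarrow>
    r x (q_after N xs) > 0"
begin

lemma split_law_pos_prefix:
  assumes "xs \<in> state_seqs i" "i < n" "x \<in> {0, 1}" "W (xs @ [x]) > 0"
  shows "W xs > 0"
  using W_split[OF assms(1,2)] W_nonneg[of "xs @ [0]"] W_nonneg[of "xs @ [1]"] assms(3,4) by auto

lemma path_weight_pos:
  "xs \<in> state_seqs i \<Longrightarrow> i \<le> n \<Longrightarrow> W xs > 0 \<Longrightarrow> path_weight r N xs > 0"
proof (induction i arbitrary: xs)
  case (Suc i)
  then obtain ys x where xs: "xs = ys @ [x]" "ys \<in> state_seqs i" "x \<in> {0, 1}"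
    by (cases xs rule: rev_cases) (auto simp: state_seqs_def)
  have *: "W (ys @ [x]) > 0" "i < n" using Suc.prems xs by auto
  have "W ys > 0" using split_law_pos_prefix[OF xs(2) *(2) xs(3) *(1)] .
  thus ?case using Suc.IH[OF xs(2)] r_pos[OF xs(2) *(2) xs(3) *(1)] *(2) xs(1)
    by (simp add: path_weight_snoc)
qed simp

text \<open>Chain rule for relative entropy: the logarithm splits off the factor of the last input,
  and summing that input out of the remaining term restores \<open>W xs\<close> by
  \<open>W_split\<close>.\<close>

lemma divergence_chain_rule:
  "i \<le> n \<Longrightarrow> (\<Sum>xs\<in>state_seqs i. W xs * log 2 (W xs / path_weight r N xs)) =
    (\<Sum>j<i. \<Sum>xs\<in>state_seqs j. \<Sum>x\<in>{0, 1}.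
       W (xs @ [x]) * log 2 (W (xs @ [x]) / W xs / r x (q_after N xs)))"
proof (induction i)
  case (Suc i)
  let ?D = "\<lambda>xs x. W (xs @ [x]) * log 2 (W (xs @ [x]) / W xs / r x (q_after N xs))"
  let ?L = "\<lambda>xs. log 2 (W xs / path_weight r N xs)"
  have "(\<Sum>xs\<in>state_seqs (Suc i). W xs * ?L xs)
     = (\<Sum>xs\<in>state_seqs i. \<Sum>x\<in>{0, 1}. W (xs @ [x]) * ?L xs + ?D xs x)"
    unfolding sum_state_seqs_Suc
  proof (intro sum.cong refl)
    fix xs x assume xs: "xs \<in> state_seqs i" "x \<in> {0, 1 :: nat}"
    have i: "i < n" using Suc.prems by simp
    show "W (xs @ [x]) * ?L (xs @ [x]) = W (xs @ [x]) * ?L xs + ?D xs x"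
    proof (cases "W (xs @ [x]) = 0")
      case False
      hence pos: "W (xs @ [x]) > 0" using W_nonneg[of "xs @ [x]"] by simp
      have "W xs > 0" by (rule split_law_pos_prefix[OF xs(1) i xs(2) pos])
      moreover from this have "path_weight r N xs > 0" using path_weight_pos xs(1) i by simp
      moreover have "r x (q_after N xs) > 0" by (rule r_pos[OF xs(1) i xs(2) pos])
      ultimately show ?thesis using pos
        by (simp add: path_weight_snoc log_divide log_mult algebra_simps)
    qed simp
  qed
  also have "\<dots> = (\<Sum>xs\<in>state_seqs i. (\<Sum>x\<in>{0, 1}. W (xs @ [x])) * ?L xs) +
      (\<Sum>xs\<in>state_seqs i. \<Sum>x\<in>{0, 1}. ?D xs x)"
    by (simp only: sum.distrib sum_distrib_right)
  also have "(\<Sum>xs\<in>state_seqs i. (\<Sum>x\<in>{0, 1}. W (xs @ [x])) * ?L xs) = (\<Sum>xs\<in>state_seqs i. W xs * ?L xs)"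
    by (intro sum.cong refl arg_cong2[where f = "(*)"]) (use W_split Suc.prems in simp)
  finally show ?case using Suc by simp
qed (simp add: W_Nil)

end

end

section \<open>Comparison of the battery under the policy and under the code\<close>

text \<open>\<open>charge_rev\<close> follows the weight of a full battery along the reversed input sequence when
  the battery starts with the law left behind by an input 1.\<close>
primrec charge_rev :: "real \<Rightarrow> nat \<Rightarrow> (nat list \<Rightarrow> real) \<Rightarrow> nat list \<Rightarrow> real" where
  "charge_rev \<eta> N W [] = \<eta>"
| "charge_rev \<eta> N W (x # ys) = (if x = 1 then \<eta> * W (rev ys @ [1])
     else charge_idle \<eta> N (q_after N (rev ys)) (W (rev ys @ [0])) (charge_rev \<eta> N W ys - W (rev ys @ [1])))"

context boosted_code
begin

text \<open>Both weights obey the same monotone recursion, and the code starts at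
  \<open>0 \<le> \<eta>\<close>. For the upper bound, removing \<open>law (xs @ [1])\<close> on both
  sides leaves \<open>law (xs @ [0])\<close>, the fixed point of \<open>charge_idle\<close>.\<close>

lemma charge_rev_bounds:
  "set xs \<subseteq> {0, 1} \<Longrightarrow> length xs \<le> n \<Longrightarrow>
    charged xs \<le> charge_rev \<eta> N law (rev xs) \<and> charge_rev \<eta> N law (rev xs) \<le> law xs"
proof (induction xs rule: rev_induct)
  case Nil
  thus ?case using eta by (simp add: charged_Nil law_Nil)
next
  case (snoc x xs)
  hence IH: "charged xs \<le> charge_rev \<eta> N law (rev xs)" "charge_rev \<eta> N law (rev xs) \<le> law xs"
    and len: "length xs < n" and x: "x = 0 \<or> x = 1" by auto
  show ?case
  proof (cases "x = 1")
    case True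
    thus ?thesis using charged_one[OF len] eta law_nonneg[of "xs @ [1]"]
      by (auto simp: mult_left_le_one_le)
  next
    case False
    thus ?thesis using x charged_idle[OF len] IH law_split[OF len] eta(2)
      by (auto intro!: charge_idle_mono charge_idle_le)
  qed
qed

end

section \<open>The bound for counter limit zero\<close>

lemma upper_bound_zero_ge_1:
  assumes "0 \<le> \<eta>" "\<eta> \<le> 1"
  shows "1 \<le> upper_bound \<eta> 0"
proof -
  define f where "f u s = (if u = (1::nat) then s else (0::nat))" for u s
  \<comment> \<open>The two symbols alternate deterministically: symbol 0 sends a zero, which for
    \<open>N = 0\<close> always charges the battery, and symbol 1 then sends a one.\<close>
  define P where "P u' u q = (if u' \<noteq> u then 1 else (0::real))" for u' u q :: nat
  \<comment> \<open>Half of the mass lies after symbol 0, with a full battery, and half after symbol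
    1, with a Bernoulli(\<open>\<eta>\<close>) battery.\<close>
  define \<pi> where "\<pi> w = (if w = (1, 0, 0) then 1 / 2 else if w = (1, 1, 0) then \<eta> / 2
     else if w = (0, 1, 0) then (1 - \<eta>) / 2 else 0)" for w :: "nat \<times> nat \<times> nat"
  have two: "{0..<2::nat} = {0, 1}" by auto
  have Om: "Omega 2 0 = {(0, 0, 0), (0, 1, 0), (1, 0, 0), (1, 1, 0)}"
    unfolding Omega_def two by auto
  have K: "kernelT \<eta> 0 f P (s', u', 0) (s, u, 0) = (if u' = u then 0 else
      if u' = 1 \<and> s = 1 then if s' = 1 then \<eta> else 1 - \<eta> else if s' = 1 then 1 else 0)"
    if "s \<in> {0, 1}" "s' \<in> {0, 1}" "u \<in> {0, 1}" "u' \<in> {0, 1}" for s s' u u'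
    using that by (elim insertE emptyE)
      (simp_all add: kernelT_def P_def f_def gU_def PU_def behc_law_def)
  have step: "(\<Sum>w\<in>Omega 2 0. \<rho> w * kernelT \<eta> 0 f P (0, 0, 0) w) = 0"
    "(\<Sum>w\<in>Omega 2 0. \<rho> w * kernelT \<eta> 0 f P (1, 0, 0) w) = \<rho> (0, 1, 0) + \<rho> (1, 1, 0)"
    "(\<Sum>w\<in>Omega 2 0. \<rho> w * kernelT \<eta> 0 f P (0, 1, 0) w) = \<rho> (1, 0, 0) * (1 - \<eta>)"
    "(\<Sum>w\<in>Omega 2 0. \<rho> w * kernelT \<eta> 0 f P (1, 1, 0) w) = \<rho> (0, 0, 0) + \<rho> (1, 0, 0) * \<eta>"
    for \<rho> by (simp_all add: Om K)
  have sum4: "(\<Sum>w\<in>Omega 2 0. \<rho> w) = \<rho> (0, 0, 0) + \<rho> (0, 1, 0) + \<rho> (1, 0, 0) + \<rho> (1, 1, 0)"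
    for \<rho> :: "_ \<Rightarrow> real" by (simp add: Om)
  have all4: "(\<forall>w\<in>Omega 2 0. Q w) \<longleftrightarrow> Q (0, 0, 0) \<and> Q (0, 1, 0) \<and> Q (1, 0, 0) \<and> Q (1, 1, 0)"
    for Q by (simp add: Om)
  have \<pi>_simps: "\<pi> (0, 0, 0) = 0" "\<pi> (0, 1, 0) = (1 - \<eta>) / 2" "\<pi> (1, 0, 0) = 1 / 2"
    "\<pi> (1, 1, 0) = \<eta> / 2"
    by (simp_all add: \<pi>_def)
  have \<pi>_0: "\<pi> w = 0" if "w \<notin> Omega 2 0" for w
    using that by (auto simp: \<pi>_def Om)
  have stat: "stationary \<eta> 0 2 f P \<pi>"
    unfolding stationary_def all4 step unfolding sum4 \<pi>_simps using assms \<pi>_0 by (simp add: field_simps)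
  have uniq: "\<rho> = \<pi>" if "stationary \<eta> 0 2 f P \<rho>" for \<rho>
  proof
    fix w
    have eqs: "\<rho> (0, 0, 0) = 0" "\<rho> (1, 0, 0) = \<rho> (0, 1, 0) + \<rho> (1, 1, 0)"
      "\<rho> (1, 1, 0) = \<rho> (0, 0, 0) + \<rho> (1, 0, 0) * \<eta>" "\<rho> (0, 1, 0) = \<rho> (1, 0, 0) * (1 - \<eta>)"
      "\<rho> (0, 0, 0) + \<rho> (0, 1, 0) + \<rho> (1, 0, 0) + \<rho> (1, 1, 0) = 1"
      and \<rho>_0: "w \<notin> Omega 2 0 \<Longrightarrow> \<rho> w = 0"
      using that unfolding stationary_def all4 step unfolding sum4 by blast+
    have half: "\<rho> (1, 0, 0) = 1 / 2" using eqs(1,2,5) by linarith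
    have "\<forall>w\<in>Omega 2 0. \<rho> w = \<pi> w"
      unfolding all4 \<pi>_simps using eqs(1,3,4) unfolding half by simp
    thus "\<rho> w = \<pi> w" using \<rho>_0 \<pi>_0 by metis
  qed
  have the: "(THE \<pi>. stationary \<eta> 0 2 f P \<pi>) = \<pi>"
    using stat uniq by (intro the_equality)
  \<comment> \<open>The input is a fair bit determined by \<open>u'\<close>, and the counter is
    constant, so the mutual information is exactly one bit.\<close>
  have J: "joint_uux_q \<eta> 0 f P \<pi> (u', u) x 0 =
     (if (u', u, x) = (0, 1, 0) \<or> (u', u, x) = (1, 0, 1) then 1 / 2 else 0)"
    if "u' \<in> {0, 1}" "u \<in> {0, 1}" "x \<in> {0, 1}" for u' u x
    using that by (elim insertE emptyE)
      (simp_all add: joint_uux_q_def \<pi>_def P_def f_def gU_def PU_def behc_law_def field_simps)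
  have pairs: "{0, 1 :: nat} \<times> {0, 1 :: nat} = {(0, 0), (0, 1), (1, 0), (1, 1)}" by auto
  have "cond_mi ({0..<2} \<times> {0..<2}) {0, 1} {0..0} (joint_uux_q \<eta> 0 f P \<pi>) = 1"
    unfolding two cond_mi_def pairs by (simp add: J)
  moreover have "valid_f 2 f" by (auto simp: valid_f_def f_def)
  moreover have "valid_policy 2 0 P" unfolding valid_policy_def two by (auto simp: P_def)
  moreover have "\<exists>!\<pi>. stationary \<eta> 0 2 f P \<pi>" using stat uniq by blast
  ultimately have "ereal 1 \<in> {ereal (cond_mi ({0..<k} \<times> {0..<k}) {0, 1} {0..0}
       (joint_uux_q \<eta> 0 f P (THE \<pi>. stationary \<eta> 0 k f P \<pi>))) | k f P. k \<ge> 1 \<and> valid_f k f \<and>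
       valid_policy k 0 P \<and> (\<exists>!\<pi>. stationary \<eta> 0 k f P \<pi>)}"
    by (intro CollectI exI[of _ 2] exI[of _ f] exI[of _ P]) (simp add: the)
  hence "ereal 1 \<le> upper_bound \<eta> 0" unfolding upper_bound_def by (rule Sup_upper)
  thus ?thesis by (simp add: one_ereal_def)
qed

section \<open>The capacity bound\<close>

lemma num_msgs_ge: "2 powr (real n * R) \<le> real (num_msgs R n)"
  unfolding num_msgs_def by linarith

lemma num_msgs_pos: "1 \<le> num_msgs R n"
  unfolding num_msgs_def by (simp add: Suc_le_eq)

text \<open>The bound for one code of finite length. The loss of one bit and the
  \<open>N + 1\<close> extra symbols per block disappear when \<open>n\<close> grows.\<close>

lemma code_rate_le:
  assumes eta: "0 \<le> \<eta>" "\<eta> \<le> 1" and n: "n \<ge> 1" and M: "M \<ge> 1" and valid: "valid_code N e n M"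
  shows "err_prob \<eta> N e d n M \<le> 1"
    and "ereal (((1 - err_prob \<eta> N e d n M) * log 2 (real M) - 1) / real (Suc (n + N))) \<le> upper_bound \<eta> N"
proof -
  let ?\<epsilon> = "err_prob \<eta> N e d n M"
  define W where "W = boosted_code.law \<eta> N e"
  define V where "V m xs = charge_rev \<eta> N (W m) (rev xs)" for m xs
  have code: "boosted_code \<eta> e m n" if "m \<in> {1..M}" for m
  proof
    fix sl i assume "sl \<in> state_seqs n" "i < n"
    moreover from this have "Suc i \<in> {1..n}" by simp
    ultimately show "enc_x e m sl n ! i \<le> (0 # sl) ! i"
      using valid that unfolding valid_code_def by fastforce
  qed (use eta in auto)
  have W_Nil: "W m [] = 1" if "m \<in> {1..M}" for m
    unfolding W_def by (rule boosted_code.law_Nil[OF code[OF that]])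
  have W_nonneg: "0 \<le> W m xs" if "m \<in> {1..M}" for m xs
    unfolding W_def by (rule boosted_code.law_nonneg[OF code[OF that]])
  have W_split: "W m xs = W m (xs @ [0]) + W m (xs @ [1])"
    if "m \<in> {1..M}" "xs \<in> state_seqs i" "i < n" for m xs i
    using boosted_code.law_split[OF code[OF that(1)], of xs] that(2,3)
    by (simp add: W_def state_seqs_def)
  have W_sum: "(\<Sum>xs\<in>state_seqs n. W m xs) = 1" if "m \<in> {1..M}" for m
    using W_Nil W_nonneg W_split that by (intro split_law_sum[where n = n]) auto
  have err: "?\<epsilon> = (1 / real M) * (\<Sum>m\<in>{1..M}. \<Sum>xs\<in>state_seqs n. W m xs * (if d xs \<noteq> m then 1 else 0))"
    unfolding err_prob_def W_def
    by (intro arg_cong2[where f = "(*)"] sum.cong refl boosted_code.sum_law[OF code, symmetric]) auto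
  have "(\<Sum>m\<in>{1..M}. \<Sum>xs\<in>state_seqs n. W m xs * (if d xs \<noteq> m then 1 else 0))
     \<le> (\<Sum>m\<in>{1..M}. \<Sum>xs\<in>state_seqs n. W m xs)"
    using W_nonneg by (intro sum_mono) auto
  also have "\<dots> = real M" using W_sum by simp
  finally show "?\<epsilon> \<le> 1" unfolding err using M by (simp add: field_simps)
  note fano = fano_change_of_measure[OF finite_state_seqs M W_nonneg W_sum _ _ _ err]
  show "ereal (((1 - ?\<epsilon>) * log 2 (real M) - 1) / real (Suc (n + N))) \<le> upper_bound \<eta> N"
  proof (cases "N = 0")
    case True
    \<comment> \<open>For \<open>N = 0\<close> the uniform measure on inputs suffices: its
      divergence is at most \<open>n\<close> bits, so the rate is at most 1, which
      \<open>upper_bound_zero_ge_1\<close> covers.\<close>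
    let ?r = "\<lambda>x q. 1 / 2 :: real"
    have pw: "path_weight ?r N xs = 1 / 2 ^ n" if "xs \<in> state_seqs n" for xs
      using that by (simp add: path_weight_def state_seqs_def power_one_over)
    have "(1 - ?\<epsilon>) * log 2 (real M) - 1 \<le> (1 / real M) *
        (\<Sum>m\<in>{1..M}. \<Sum>xs\<in>state_seqs n. W m xs * log 2 (W m xs / path_weight ?r N xs))"
    proof (rule fano)
      show "(\<Sum>xs\<in>state_seqs n. path_weight ?r N xs) \<le> 1" by (rule path_weight_sum) auto
    qed (simp_all add: pw)
    also have "\<dots> \<le> (1 / real M) * (\<Sum>m\<in>{1..M}. \<Sum>xs\<in>state_seqs n. W m xs * real n)"
    proof (rule mult_left_mono[OF sum_mono[OF sum_mono]])
      fix m xs assume *: "m \<in> {1..M}" "xs \<in> state_seqs n"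
      have "W m xs \<le> (\<Sum>xs\<in>state_seqs n. W m xs)"
        using * W_nonneg by (intro member_le_sum) auto
      hence le1: "W m xs \<le> 1" using W_sum * by simp
      show "W m xs * log 2 (W m xs / path_weight ?r N xs) \<le> W m xs * real n"
      proof (cases "W m xs = 0")
        case False
        hence pos: "W m xs > 0" using W_nonneg[OF *(1), of xs] by simp
        have "log 2 (W m xs / path_weight ?r N xs) = log 2 (W m xs) + real n"
          using pos by (simp add: pw[OF *(2)] log_mult log_nat_power)
        also have "\<dots> \<le> real n" using pos le1 by simp
        finally show ?thesis using pos by simp
      qed simp
    qed simp
    also have "\<dots> = real n"
      using W_sum M by (simp flip: sum_distrib_right)
    finally have "((1 - ?\<epsilon>) * log 2 (real M) - 1) / real (Suc (n + N)) \<le> 1"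
      using True by (simp add: field_simps)
    hence "ereal (((1 - ?\<epsilon>) * log 2 (real M) - 1) / real (Suc (n + N))) \<le> 1"
      by (simp add: one_ereal_def)
    also have "\<dots> \<le> upper_bound \<eta> N" using upper_bound_zero_ge_1[OF eta] True by simp
    finally show ?thesis .
  next
    case False
    \<comment> \<open>\<open>V_Nil\<close>, \<open>V_one\<close> and \<open>V_idle\<close> hold by
      the recursion for \<open>charge_rev\<close>. \<open>V_ge\<close> combines
      \<open>charge_rev_bounds\<close> with the fact that the code itself sends a one only from a
      full battery.\<close>
    interpret block_policy \<eta> N n M W V
    proof
      show "N \<ge> 1" using False by simp
    next
      fix m xs i assume *: "m \<in> {1..M}" "xs \<in> state_seqs i" "i < n"
      interpret boosted_code \<eta> N e m n using *(1) by (rule code)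
      have xs: "set xs \<subseteq> {0, 1}" "length xs < n" using * by (auto simp: state_seqs_def)
      note b = charge_rev_bounds[OF xs(1) less_imp_le[OF xs(2)]]
      show "W m (xs @ [1]) \<le> V m xs"
        using b law_one_le_charged[OF xs(2)] by (simp add: V_def W_def)
      show "V m xs \<le> W m xs" using b by (simp add: V_def W_def)
    qed (use eta n M W_Nil W_nonneg W_split in \<open>simp_all add: V_def\<close>)
    have pos: "output_law x (q_after N xs) > 0"
      if "m \<in> {1..M}" "xs \<in> state_seqs i" "i < n" "x \<in> {0, 1}" "W m (xs @ [x]) > 0" for m xs i x
      using that by (intro output_law_pos[of m]) (auto simp: hist_def)
    have hist_sum: "(\<Sum>xs\<in>hist. g xs) = (\<Sum>j<n. \<Sum>xs\<in>state_seqs j. g xs)" for g :: "_ \<Rightarrow> real"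
      unfolding hist_def by (rule sum.UNION_disjoint) (simp, simp, auto simp: state_seqs_def)
    have "(1 - ?\<epsilon>) * log 2 (real M) - 1 \<le> (1 / real M) *
        (\<Sum>m\<in>{1..M}. \<Sum>xs\<in>state_seqs n. W m xs * log 2 (W m xs / path_weight output_law N xs))"
    proof (rule fano)
      show "0 \<le> path_weight output_law N xs" for xs
        using output_law_nonneg by (rule path_weight_nonneg)
      show "(\<Sum>xs\<in>state_seqs n. path_weight output_law N xs) \<le> 1"
        using output_law_nonneg output_law_sum by (intro path_weight_sum) auto
      fix m xs assume *: "m \<in> {1..M}" "xs \<in> state_seqs n" "W m xs > 0"
      show "path_weight output_law N xs > 0"
        by (rule path_weight_pos[of "W m" n]) (use * W_Nil W_nonneg W_split pos in auto)
    qed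
    also have "\<dots> = (\<Sum>m\<in>{1..M}. \<Sum>xs\<in>hist. \<Sum>x\<in>{0, 1}. W m (xs @ [x]) *
        log 2 (W m (xs @ [x]) / W m xs / output_law x (q_after N xs))) / real M"
    proof -
      have "(\<Sum>xs\<in>state_seqs n. W m xs * log 2 (W m xs / path_weight output_law N xs))
         = (\<Sum>xs\<in>hist. \<Sum>x\<in>{0, 1}. W m (xs @ [x]) *
        log 2 (W m (xs @ [x]) / W m xs / output_law x (q_after N xs)))" if "m \<in> {1..M}" for m
        unfolding hist_sum
        by (rule divergence_chain_rule[of "W m" n]) (use that W_Nil W_nonneg W_split pos in auto)
      thus ?thesis by simp
    qed
    also have "\<dots> \<le> real (Suc (n + N)) * cond_mi ({0..<k} \<times> {0..<k}) {0, 1} {0..N} law_uux"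
      by (rule cond_mi_ge_code_divergence)
    finally have "((1 - ?\<epsilon>) * log 2 (real M) - 1) / real (Suc (n + N))
       \<le> cond_mi ({0..<k} \<times> {0..<k}) {0, 1} {0..N} law_uux"
      by (subst pos_divide_le_eq) (simp_all add: mult.commute del: of_nat_Suc)
    hence "ereal (((1 - ?\<epsilon>) * log 2 (real M) - 1) / real (Suc (n + N)))
       \<le> ereal (cond_mi ({0..<k} \<times> {0..<k}) {0, 1} {0..N} law_uux)" by simp
    also have "\<dots> \<le> upper_bound \<eta> N"
      unfolding upper_bound_def law_uux_def \<pi>_def
      using k_ge valid_inp valid_pol stationary_ex1
      by (intro Sup_upper CollectI exI[of _ k] exI[of _ inp] exI[of _ pol]) simp
    finally show ?thesis .
  qed
qed

lemma achievable_le_upper_bound: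
  assumes eta: "0 \<le> \<eta>" "\<eta> \<le> 1" and ach: "achievable \<eta> N R"
  shows "ereal R \<le> upper_bound \<eta> N"
proof -
  obtain E D where valid: "\<And>n. valid_code N (E n) n (num_msgs R n)"
    and lim: "(\<lambda>n. err_prob \<eta> N (E n) (D n) n (num_msgs R n)) \<longlonglongrightarrow> 0"
    using ach unfolding achievable_def by blast
  define \<epsilon> where "\<epsilon> n = err_prob \<eta> N (E n) (D n) n (num_msgs R n)" for n
  define b where "b n = ((1 - \<epsilon> n) * (real n * R) - 1) / real (Suc (n + N))" for n
  have b_le: "ereal (b n) \<le> upper_bound \<eta> N" if "n \<ge> 1" for n
  proof -
    note c = code_rate_le[OF eta that num_msgs_pos valid, where d = "D n", folded \<epsilon>_def]
    have "real n * R = log 2 (2 powr (real n * R))" by simp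
    also have "\<dots> \<le> log 2 (real (num_msgs R n))"
      using num_msgs_ge[of n R] num_msgs_pos[of R n] by (subst log_le_cancel_iff) auto
    finally have "(1 - \<epsilon> n) * (real n * R) \<le> (1 - \<epsilon> n) * log 2 (real (num_msgs R n))"
      using c(1) by (intro mult_left_mono) auto
    hence "b n \<le> ((1 - \<epsilon> n) * log 2 (real (num_msgs R n)) - 1) / real (Suc (n + N))"
      unfolding b_def by (intro divide_right_mono) auto
    thus ?thesis using c(2) by (meson ereal_less_eq(3) order_trans)
  qed
  have inv: "(\<lambda>n. inverse (real (Suc (n + N)))) \<longlonglongrightarrow> 0"
    using LIMSEQ_ignore_initial_segment[OF LIMSEQ_inverse_real_of_nat, of N] by simp
  \<comment> \<open>Substituting \<open>n = c - (N + 1)\<close> isolates the vanishing share of the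
    recharging symbols and makes the limit a matter of elementary rules.\<close>
  have b_eq: "b n = (1 - \<epsilon> n) * R * (1 - real (Suc N) * inverse (real (Suc (n + N))))
      - inverse (real (Suc (n + N)))" for n
  proof -
    define c where "c = real (Suc (n + N))"
    have n_eq: "real n = c - real (Suc N)" and "c \<noteq> 0" by (auto simp: c_def)
    thus ?thesis unfolding b_def c_def[symmetric] unfolding n_eq by (simp add: field_simps)
  qed
  have "b \<longlonglongrightarrow> (1 - 0) * R * (1 - real (Suc N) * 0) - 0"
    unfolding b_eq using lim inv unfolding \<epsilon>_def[symmetric] by (intro tendsto_intros)
  hence "(\<lambda>n. ereal (b n)) \<longlonglongrightarrow> ereal R" by simp
  moreover have "\<exists>n0. \<forall>n\<ge>n0. ereal (b n) \<le> upper_bound \<eta> N" using b_le by blast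
  ultimately show ?thesis by (rule LIMSEQ_le_const2)
qed

theorem theorem4:
  fixes \<eta> :: real and N :: nat
  assumes "0 \<le> \<eta>" and "\<eta> \<le> 1"
  shows "boosted_capacity \<eta> N \<le> upper_bound \<eta> N"
  unfolding boosted_capacity_def
  using achievable_le_upper_bound[OF assms] by (auto intro!: Sup_least)

end
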